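(* Let $n\ge 1$, $s\ge 1$ be integers. Let $f:B^n\to\mathbb{R}$ be an infinitely differentiable function with zero set $Z=\{x\in B^n: f(x)=0\}$, and let $\omega=(\omega_1,\ldots,\omega_n):[-1,1]\to\mathbb{R}^n$ be a polynomial parametric curve of degree $s$ (each $\omega_i$ is a real polynomial in $t$ of degree at most $s$) with $\omega([-1,1])\subset B^n$ and $\omega([-1,1])\not\subset Z$. Put $m=\max_{t\in[-1,1]}|f(\omega(t))|>0$. Assume that $Z\cap\omega([-1,1])$ is infinite. Then, with the integers $d_j$, intervals $I_j$, numbers $\theta_j$ and constants $C(n,d,s)$ defined in the context, for each $j=2,3,\ldots$ $$\sum_{|\alpha|\in I_j}\|f^{(\alpha)}\|\ \ge\ \frac{m\,(d_j+1)!\,C(n,d_j,s)}{2^{d_j+1}} ,$$ where $\|f^{(\alpha)}\|=\max_{t\in[-1,1]}|f^{(\alpha)}(\omega(t))|$. In particular, there are infinitely many growing derivative orders $k_j\in I_j$ (that is, there are an infinite set $J\subset\{2,3,\ldots\}$ and integers $k_j\in I_j$, $j\in J$, strictly increasing in $j$) for which $$\|f^{(k_j)}\|\ \ge\ \frac{m\,(k_j+1)!\,C(n,d_j,s)}{\theta_j\,2^{d_j+1}} .$$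
   Context: $B^n\subset\mathbb{R}^n$ is the closed unit ball; infinitely differentiable on $B^n$ means all partial derivatives of all orders exist and extend continuously up to the boundary. For a multi-index $\alpha=(\alpha_1,\ldots,\alpha_n)$ of nonnegative integers, $|\alpha|=\alpha_1+\cdots+\alpha_n$ and $f^{(\alpha)}=\partial^{|\alpha|}f/\partial x_1^{\alpha_1}\cdots\partial x_n^{\alpha_n}$. For an integer $k\ge1$, $\|f^{(k)}\|=\max_{x\in B^n}\|f^{(k)}(x)\|$, where $\|f^{(k)}(x)\|=\sum_{|\alpha|=k}|f^{(\alpha)}(x)|$. $[x]$ denotes the integer part of $x$. For integers $d\ge 0$ put $$\eta_{d,s}=\left[\frac{d+1}{s+1}\right]+1,\qquad C(n,d,s)=\frac{1}{s^{2(d+1)}(n+1)^{d+1}(d+1)^{(d+1)(n+2)}} .$$ Put $d_1=5s$, and for $j=2,3,\ldots$ define $d_j$ inductively as the smallest integer $d$ for which $\eta_{d,s}>d_{j-1}$. Put $I_j=[\eta_{d_j,s},\,d_j+1]$ and $\theta_j=d_j+1-\eta_{d_j,s}$. The sum over $|\alpha|\in I_j$ runs over all multi-indices $\alpha$ with $\eta_{d_j,s}\le|\alpha|\le d_j+1$. *)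

theory Defs
  imports "HOL-Analysis.Analysis" "HOL-Computational_Algebra.Polynomial"
begin

definition partial_deriv :: "'n \<Rightarrow> (real ^ 'n \<Rightarrow> real) \<Rightarrow> real ^ 'n \<Rightarrow> real" where
  "partial_deriv i g x = deriv (\<lambda>h. g (x + h *\<^sub>R axis i 1)) 0"

definition iter_partial :: "'n list \<Rightarrow> (real ^ 'n \<Rightarrow> real) \<Rightarrow> real ^ 'n \<Rightarrow> real" where
  "iter_partial is f = foldr partial_deriv is f"

text \<open>Partial derivatives are taken in the open ball, where they depend only on the values of
  the function in that open ball. Continuity of \<open>f\<close> on the closed ball says that its
  boundary values are those of its continuous extension.\<close>

definition smooth_on_ball :: "(real ^ 'n::finite \<Rightarrow> real) \<Rightarrow> bool" where
  "smooth_on_ball f \<longleftrightarrow>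
     continuous_on (cball 0 1) f \<and>
     (\<forall>is. (\<forall>i. \<forall>x\<in>ball 0 1.
               (\<lambda>h. iter_partial is f (x + h *\<^sub>R axis i 1)) differentiable (at 0)) \<and>
           (\<exists>g. continuous_on (cball 0 1) g \<and> (\<forall>x\<in>ball 0 1. g x = iter_partial is f x)))"

text \<open>The multi-index derivative on the closed ball. The index type carries no order, so some
  list of directions in which each \<open>i\<close> occurs \<open>\<alpha> i\<close> times is chosen; for smooth \<open>f\<close> the choice
  is immaterial, since mixed partial derivatives commute. The limit is the value of the continuous
  extension; at interior points it is the derivative itself.\<close>

definition multi_deriv :: "('n \<Rightarrow> nat) \<Rightarrow> (real ^ 'n::finite \<Rightarrow> real) \<Rightarrow> real ^ 'n \<Rightarrow> real" where
  "multi_deriv \<alpha> f x =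
     Lim (at x within ball 0 1) (iter_partial (SOME is. \<forall>i. count_list is i = \<alpha> i) f)"

definition msize :: "('n::finite \<Rightarrow> nat) \<Rightarrow> nat" where
  "msize \<alpha> = (\<Sum>i\<in>UNIV. \<alpha> i)"

text \<open>The suprema below are maxima of continuous functions on compact sets when \<open>f\<close> is smooth
  and \<open>\<omega>\<close> is a continuous curve in the closed ball.\<close>

definition order_norm :: "nat \<Rightarrow> (real ^ 'n::finite \<Rightarrow> real) \<Rightarrow> real" where
  "order_norm k f = (SUP x\<in>cball 0 1. \<Sum>\<alpha> | msize \<alpha> = k. \<bar>multi_deriv \<alpha> f x\<bar>)"

definition curve_norm :: "(real \<Rightarrow> real ^ 'n) \<Rightarrow> ('n \<Rightarrow> nat) \<Rightarrow> (real ^ 'n::finite \<Rightarrow> real) \<Rightarrow> real" where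
  "curve_norm \<omega> \<alpha> f = (SUP t\<in>{-1..1}. \<bar>multi_deriv \<alpha> f (\<omega> t)\<bar>)"

definition eta :: "nat \<Rightarrow> nat \<Rightarrow> nat" where
  "eta d s = (d + 1) div (s + 1) + 1"

definition C_const :: "nat \<Rightarrow> nat \<Rightarrow> nat \<Rightarrow> real" where
  "C_const n d s =
     1 / (real s ^ (2 * (d + 1)) * real (n + 1) ^ (d + 1) * real (d + 1) ^ ((d + 1) * (n + 2)))"

text \<open>Indexing starts at 1; the value at 0 is a dummy.\<close>

fun dseq :: "nat \<Rightarrow> nat \<Rightarrow> nat" where
  "dseq s 0 = 0"
| "dseq s (Suc 0) = 5 * s"
| "dseq s (Suc (Suc j)) = (LEAST d. eta d s > dseq s (Suc j))"

definition order_interval :: "nat \<Rightarrow> nat \<Rightarrow> nat set" where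
  "order_interval s j = {eta (dseq s j) s .. dseq s j + 1}"

definition theta :: "nat \<Rightarrow> nat \<Rightarrow> real" where
  "theta s j = real (dseq s j) + 1 - real (eta (dseq s j) s)"

end

theory Submission imports Defs begin

text \<open>Let \<open>D = d + 1\<close> and \<open>g = f \<circ> \<omega>\<close>. Interpolating \<open>g\<close> by zero at \<open>D\<close> of its zeros bounds
  \<open>m\<close> by \<open>2\<^sup>D / D!\<close> times the maximum of the \<open>D\<close>-th derivative of \<open>g\<close>. By the chain rule this
  derivative is a sum of at most \<open>(n + D)\<^sup>D\<close> products of a partial derivative of \<open>f\<close> with derivatives
  of the components of \<open>\<omega>\<close> of total order \<open>D\<close>. As those of order above \<open>s\<close> vanish, only partial
  derivatives of order at least \<open>D / s\<close> contribute, and Markov's inequality bounds the other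
  factors. The crude constants obtained are far smaller than \<open>1 / C(n, d, s)\<close>: a single \<open>\<alpha>\<close> already
  exceeds the claimed lower bound even with \<open>(d + 2)!\<close> in place of \<open>(d + 1)!\<close>, so the statement
  about the orders \<open>k\<^sub>j\<close> needs no averaging over \<open>I\<^sub>j\<close>.\<close>

section \<open>Zeros of derivatives and Markov's inequality\<close>

text \<open>Zeros are added in increasing order, and the mean value theorem gives a zero of
  \<open>h'\<close> between the old maximum and the new one. The strict bound by
  \<open>Max A\<close> keeps the zeros found distinct, and in Markov's inequality it leaves room for
  one more critical point at 1.\<close>

lemma zeros_of_derivative:
  fixes h h' :: "real \<Rightarrow> real"
  assumes "finite A" "A \<noteq> {}" "A \<subseteq> {a..b}"
    and "\<And>x. x \<in> {a..b} \<Longrightarrow> (h has_real_derivative h' x) (at x)"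
    and "\<And>x. x \<in> A \<Longrightarrow> h x = 0"
  shows "\<exists>B. finite B \<and> Suc (card B) = card A \<and> B \<subseteq> {a..<Max A} \<and> (\<forall>x\<in>B. h' x = 0)"
  using assms(1-3,5)
proof (induction A rule: finite_linorder_max_induct)
  case empty
  then show ?case by simp
next
  case (insert c A)
  have Max: "Max (insert c A) = c"
    using insert.hyps by (intro Max_eqI) (auto intro: less_imp_le)
  show ?case
  proof (cases "A = {}")
    case True
    then show ?thesis by (intro exI[of _ "{}"]) auto
  next
    case False
    then obtain B where B: "finite B" "Suc (card B) = card A" "B \<subseteq> {a..<Max A}" "\<forall>x\<in>B. h' x = 0"
      using insert by auto
    have M: "Max A \<in> A" using insert.hyps False by auto
    then have lt: "Max A < c" and MA: "a \<le> Max A" "Max A \<le> b" and c: "c \<le> b"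
      using insert by auto
    obtain z where z: "Max A < z" "z < c" "h c - h (Max A) = (c - Max A) * h' z"
      using MVT2[of "Max A" c h h'] lt assms(4) MA c by auto
    then have "h' z = 0" using insert.prems M lt by auto
    moreover have "z \<notin> B" using B(3) z by auto
    ultimately show ?thesis
      using B z insert.hyps Max MA lt
      by (intro exI[of _ "insert z B"]) force
  qed
qed

text \<open>The sequence \<open>h\<close> is a function together with its derivatives; each step
  trades one zero for one order of differentiation.\<close>

lemma iterated_Rolle:
  fixes h :: "nat \<Rightarrow> real \<Rightarrow> real"
  assumes "\<And>k x. x \<in> {a..b} \<Longrightarrow> (h k has_real_derivative h (Suc k) x) (at x)"
    and "finite A" "card A = Suc n" "A \<subseteq> {a..b}" "\<And>x. x \<in> A \<Longrightarrow> h 0 x = 0"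
  shows "\<exists>x\<in>{a..b}. h n x = 0"
  using assms
proof (induction n arbitrary: h A)
  case 0
  then show ?case by (metis card_eq_SucD insertI1 subsetD)
next
  case (Suc n)
  have ne: "A \<noteq> {}" using Suc.prems by auto
  obtain B where B: "finite B" "Suc (card B) = card A" "B \<subseteq> {a..<Max A}" "\<forall>x\<in>B. h (Suc 0) x = 0"
    using zeros_of_derivative[of A a b "h 0" "h (Suc 0)"] Suc.prems ne by blast
  have "Max A \<in> A" using Suc.prems ne by auto
  then have "B \<subseteq> {a..b}" using B(3) Suc.prems by fastforce
  then show ?case
    using Suc.IH[of "\<lambda>k. h (Suc k)" B] Suc.prems B by auto
qed

section \<open>Chebyshev polynomials and Markov's inequality\<close>

fun cheb_poly :: "nat \<Rightarrow> real poly" where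
  "cheb_poly 0 = 1"
| "cheb_poly (Suc 0) = [:0, 1:]"
| "cheb_poly (Suc (Suc n)) = [:0, 2:] * cheb_poly (Suc n) - cheb_poly n"

lemma degree_cheb_poly: "degree (cheb_poly n) \<le> n"
proof (induction n rule: cheb_poly.induct)
  case (3 n)
  have "degree ([:0, 2:] * cheb_poly (Suc n)) \<le> Suc (Suc n)"
    using degree_mult_le[of "[:0, 2::real:]" "cheb_poly (Suc n)"] 3 by simp
  then show ?case using 3 by (simp add: degree_diff_le)
qed auto

lemma poly_cheb_poly_cos: "poly (cheb_poly n) (cos x) = cos (real n * x)"
proof (induction n rule: cheb_poly.induct)
  case (3 n)
  have "cos (real (Suc (Suc n)) * x) + cos (real n * x) = 2 * cos x * cos (real (Suc n) * x)"
    using cos_plus_cos[of "real (Suc (Suc n)) * x" "real n * x"]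
    by (simp add: algebra_simps add_divide_distrib)
  then show ?case using 3 by simp
qed auto

lemma poly_cheb_poly_1: "poly (cheb_poly n) 1 = 1"
  using poly_cheb_poly_cos[of n 0] by simp

text \<open>Differentiating the recursion at 1 gives 2 + 2(n+1)^2 - n^2 = (n+2)^2. This is the
  extremal value in Markov's inequality.\<close>

lemma pderiv_cheb_poly_1: "poly (pderiv (cheb_poly n)) 1 = real n ^ 2"
  by (induction n rule: cheb_poly.induct)
     (simp_all add: pderiv_smult pderiv_mult pderiv_diff pderiv_pCons poly_cheb_poly_1
       power2_eq_square algebra_simps)

text \<open>If the derivative at the endpoint were larger than that of the Chebyshev polynomial \<open>T\<close>,
  then \<open>T - c p\<close> with suitable \<open>\<bar>c\<bar> < 1\<close> would have a critical point at \<open>1\<close> and, by the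
  alternation of \<open>T\<close>, as many zeros in \<open>(-1, 1)\<close> as its degree permits.\<close>

lemma Markov_endpoint:
  fixes p :: "real poly"
  assumes deg: "degree p \<le> s" and s: "s \<ge> 1" and bd: "\<And>x. x \<in> {-1..1} \<Longrightarrow> \<bar>poly p x\<bar> \<le> 1"
  shows "\<bar>poly (pderiv p) 1\<bar> \<le> real s ^ 2"
proof (rule ccontr)
  assume *: "\<not> ?thesis"
  \<comment> \<open>This scaling gives \<open>c p\<close> the same derivative at 1 as the Chebyshev
    polynomial; the assumed violation of the bound makes it a proper contraction.\<close>
  define c where "c = real s ^ 2 / poly (pderiv p) 1"
  have nz: "poly (pderiv p) 1 \<noteq> 0" using * by auto
  have c1: "\<bar>c\<bar> < 1" using * unfolding c_def abs_divide by (simp add: divide_less_eq)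
  define q where "q = cheb_poly s - smult c p"
  have degq: "degree q \<le> s" unfolding q_def
    using deg degree_cheb_poly[of s] by (simp add: degree_diff_le)
  have q'1: "poly (pderiv q) 1 = 0" unfolding q_def c_def
    by (simp add: pderiv_diff pderiv_smult pderiv_cheb_poly_1 nz)
  have small: "\<bar>c * poly p x\<bar> < 1" if "x \<in> {-1..1}" for x
  proof -
    have "\<bar>c * poly p x\<bar> \<le> \<bar>c\<bar> * 1" unfolding abs_mult using bd[OF that] by (intro mult_left_mono) auto
    then show ?thesis using c1 by simp
  qed
  \<comment> \<open>These are the points, decreasing in \<open>k\<close>, where the Chebyshev
    polynomial takes the values 1 and -1 alternately. The perturbation \<open>c p\<close> is too
    small to change the sign there.\<close>
  define x where "x k = cos (real k * (pi / real s))" for k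
  have x_le: "real k * (pi / real s) \<le> pi" if "k \<le> s" for k
    using that s by (simp add: field_simps)
  have x_less: "x l < x k" if "k < l" "l \<le> s" for k l
    unfolding x_def using that s x_le[of l] by (intro cos_monotone_0_pi) (auto simp: field_simps)
  have sgn: "(-1) ^ k * poly q (x k) > 0" if "k \<le> s" for k
  proof -
    have "real s * (real k * (pi / real s)) = real k * pi" using s by simp
    then have "poly (cheb_poly s) (x k) = (-1) ^ k"
      unfolding x_def poly_cheb_poly_cos by simp
    moreover have "\<bar>c * poly p (x k)\<bar> < 1" by (rule small) (simp add: x_def)
    ultimately show ?thesis unfolding q_def
      by (cases "even k") auto
  qed
  have "\<exists>y. x (Suc k) < y \<and> y < x k \<and> poly q y = 0" if "k < s" for k
  proof -
    have "poly q (x (Suc k)) * poly q (x k) < 0"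
      using sgn[of k] sgn[of "Suc k"] that by (cases "even k") (auto simp: mult_less_0_iff)
    then show ?thesis using poly_IVT[of "x (Suc k)" "x k" q] x_less[of k "Suc k"] that by auto
  qed
  then obtain y where y: "\<And>k. k < s \<Longrightarrow> x (Suc k) < y k \<and> y k < x k \<and> poly q (y k) = 0" by metis
  have y_less: "y l < y k" if "k < l" "l < s" for k l
  proof -
    have "x l \<le> x (Suc k)" using x_less[of "Suc k" l] that by (cases "l = Suc k") auto
    then show ?thesis using y[of k] y[of l] that by auto
  qed
  have inj: "inj_on y {..<s}"
    by (intro linorder_inj_onI') (use y_less in force)+
  define A where "A = y ` {..<s}"
  have A: "finite A" "card A = s" "A \<noteq> {}" using inj s by (auto simp: A_def card_image lessThan_empty_iff)
  have x1: "x k \<le> 1" "x k \<ge> -1" for k by (auto simp: x_def)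
  have Asub: "A \<subseteq> {-1..1}" "\<forall>a\<in>A. a < 1"
    using y x1 unfolding A_def by (force intro: order.trans less_imp_le order.strict_trans2)+
  \<comment> \<open>The \<open>s\<close> zeros of \<open>q\<close> yield \<open>s - 1\<close>
    critical points below 1. With 1 itself this is one more than the degree of
    \<open>pderiv q\<close> permits, so \<open>q\<close> is constant.\<close>
  obtain B where B: "finite B" "Suc (card B) = card A" "B \<subseteq> {-1..<Max A}" "\<forall>x\<in>B. poly (pderiv q) x = 0"
    using zeros_of_derivative[of A "-1" 1 "poly q" "poly (pderiv q)"] A Asub y
    by (auto simp: A_def poly_DERIV)
  have "Max A < 1" using A Asub by auto
  then have "1 \<notin> B" using B(3) by auto
  then have card: "card (insert 1 B) = s" using B A by simp
  have "pderiv q = 0"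
  proof (rule ccontr)
    assume nz': "pderiv q \<noteq> 0"
    have "card (insert 1 B) \<le> card {x. poly (pderiv q) x = 0}"
      using B q'1 by (intro card_mono poly_roots_finite nz') auto
    also have "\<dots> \<le> degree (pderiv q)" by (rule card_poly_roots_bound[OF nz'])
    also have "\<dots> \<le> s - 1" using degq by (simp add: degree_pderiv)
    finally show False using card s by simp
  qed
  then obtain e where e: "q = [:e:]" using pderiv_iszero by blast
  have "poly q (y 0) = 0" "poly q (x 0) > 0" using y[of 0] sgn[of 0] s by auto
  then show False by (simp add: e)
qed

text \<open>An interior point becomes an endpoint after rescaling to the longer of the intervals \<open>[-1, x]\<close>
  and \<open>[x, 1]\<close>, at the cost of a factor 2 in Markov's inequality.\<close>

lemma Markov_weak:
  fixes p :: "real poly"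
  assumes deg: "degree p \<le> s" and bd: "\<And>x. x \<in> {-1..1} \<Longrightarrow> \<bar>poly p x\<bar> \<le> 1"
    and x: "x \<in> {-1..1}"
  shows "\<bar>poly (pderiv p) x\<bar> \<le> 2 * real s ^ 2"
proof (cases "s = 0")
  case True
  then show ?thesis using deg by (metis abs_zero le_zero_eq pderiv_eq_0_iff poly_0 mult_zero_right order_refl power_zero_numeral of_nat_0)
next
  case False
  \<comment> \<open>With \<sigma> the sign of \<open>x\<close>, the affine map \<open>q\<close>
    sends 1 to \<open>x\<close> and -1 to \<open>-\<sigma>\<close>. Its slope has absolute value at
    least 1/2.\<close>
  define \<sigma> :: real where "\<sigma> = (if x \<ge> 0 then 1 else -1)"
  define q where "q = [:\<sigma> * (\<bar>x\<bar> - 1) / 2, \<sigma> * (1 + \<bar>x\<bar>) / 2:]"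
  have q: "poly q u = \<sigma> * ((\<bar>x\<bar> - 1) / 2 + u * ((1 + \<bar>x\<bar>) / 2))" for u
    by (simp add: q_def algebra_simps)
  have q1: "poly q 1 = x" by (simp add: q \<sigma>_def field_simps)
  have "poly q u \<in> {-1..1}" if "u \<in> {-1..1}" for u
  proof -
    have "(1 + \<bar>x\<bar>) / 2 * u \<le> (1 + \<bar>x\<bar>) / 2 * 1" "(1 + \<bar>x\<bar>) / 2 * u \<ge> (1 + \<bar>x\<bar>) / 2 * (-1)"
      using that by (intro mult_left_mono; simp)+
    moreover have "\<bar>x\<bar> \<le> 1" using x by auto
    ultimately show ?thesis unfolding q by (auto simp: \<sigma>_def field_simps)
  qed
  then have "\<bar>poly (pderiv (pcompose p q)) 1\<bar> \<le> real s ^ 2"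
    using False deg bd by (intro Markov_endpoint) (auto simp: poly_pcompose degree_pcompose q_def \<sigma>_def intro: order.trans[OF mult_le_mono2])
  moreover have "\<bar>poly (pderiv (pcompose p q)) 1\<bar> = \<bar>poly (pderiv p) x\<bar> * ((1 + \<bar>x\<bar>) / 2)"
    by (simp add: pderiv_pcompose poly_pcompose q1 abs_mult) (simp add: q_def pderiv_pCons abs_mult \<sigma>_def)
  moreover have "\<bar>poly (pderiv p) x\<bar> * ((1 + \<bar>x\<bar>) / 2) \<ge> \<bar>poly (pderiv p) x\<bar> * (1 / 2)"
    by (intro mult_left_mono) auto
  ultimately show ?thesis by simp
qed

text \<open>\<open>Markov_weak\<close> is applied repeatedly, each time to the derivative divided by
  the bound already obtained; the degree stays at most \<open>s\<close>.\<close>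

lemma Markov_higher:
  fixes p :: "real poly"
  assumes deg: "degree p \<le> s" and s: "s \<ge> 1" and bd: "\<And>x. x \<in> {-1..1} \<Longrightarrow> \<bar>poly p x\<bar> \<le> 1"
    and x: "x \<in> {-1..1}"
  shows "\<bar>poly ((pderiv ^^ k) p) x\<bar> \<le> (2 * real s ^ 2) ^ k"
  using x
proof (induction k arbitrary: x)
  case (Suc k)
  define B where "B = (2 * real s ^ 2) ^ k"
  have B: "B > 0" using s by (simp add: B_def)
  have "\<bar>poly (pderiv (smult (1 / B) ((pderiv ^^ k) p))) x\<bar> \<le> 2 * real s ^ 2"
  proof (rule Markov_weak)
    show "degree (smult (1 / B) ((pderiv ^^ k) p)) \<le> s" using deg by (auto simp: degree_higher_pderiv intro: le_trans[OF diff_le_self])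
    show "\<bar>poly (smult (1 / B) ((pderiv ^^ k) p)) y\<bar> \<le> 1" if "y \<in> {-1..1}" for y
      using Suc.IH[OF that, folded B_def] B by (simp add: abs_mult)
  qed fact
  then show ?case using B unfolding power_Suc B_def[symmetric] by (simp add: pderiv_smult abs_mult field_simps)
qed (use bd in auto)

section \<open>Partial derivatives on the ball\<close>

text \<open>The sign of \<open>h\<close> is left open so that steps along a coordinate axis need no
  case distinction.\<close>

lemma MVT_between:
  fixes f f' :: "real \<Rightarrow> real"
  assumes "\<And>t. \<bar>t\<bar> \<le> \<bar>h\<bar> \<Longrightarrow> (f has_real_derivative f' t) (at t)"
  shows "\<exists>z. \<bar>z\<bar> \<le> \<bar>h\<bar> \<and> f h - f 0 = h * f' z"
proof (cases h "0::real" rule: linorder_cases)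
  case less
  then obtain z where "h < z" "z < 0" "f 0 - f h = (0 - h) * f' z"
    using MVT2[of h 0 f f'] assms by auto
  then show ?thesis by (intro exI[of _ z]) auto
next
  case greater
  then obtain z where "0 < z" "z < h" "f h - f 0 = (h - 0) * f' z"
    using MVT2[of 0 h f f'] assms by auto
  then show ?thesis by (intro exI[of _ z]) auto
qed auto

lemma partial_along_line:
  fixes g :: "real ^ 'n::finite \<Rightarrow> real"
  assumes "((\<lambda>h. g ((x + t *\<^sub>R axis i 1) + h *\<^sub>R axis i 1)) has_real_derivative D) (at 0)"
  shows "((\<lambda>h. g (x + h *\<^sub>R axis i 1)) has_real_derivative D) (at t)"
proof -
  have "(\<lambda>h. g (x + (h + t) *\<^sub>R axis i 1)) = (\<lambda>h. g ((x + t *\<^sub>R axis i 1) + h *\<^sub>R axis i 1))"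
    by (simp add: algebra_simps)
  then show ?thesis
    using assms DERIV_shift[of "\<lambda>h. g (x + h *\<^sub>R axis i 1)" D 0 t] by simp
qed

text \<open>The increment is split into moves along one axis at a time. The mean value theorem
  evaluates each move by a partial derivative at a nearby point, which by continuity is close to its
  value at \<open>x\<close>.\<close>

lemma has_derivative_of_partials:
  fixes g :: "real ^ 'n::finite \<Rightarrow> real"
  assumes S: "open S" "x \<in> S"
    and d: "\<And>y i. y \<in> S \<Longrightarrow> ((\<lambda>h. g (y + h *\<^sub>R axis i 1)) has_real_derivative d i y) (at 0)"
    and cont: "\<And>i. continuous_on S (d i)"
  shows "(g has_derivative (\<lambda>v. \<Sum>i\<in>UNIV. v $ i * d i x)) (at x)"
  unfolding has_derivative_at_alt
proof (intro conjI allI impI)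
  show "bounded_linear (\<lambda>v. \<Sum>i\<in>UNIV. v $ i * d i x)"
    by (intro bounded_linear_sum bounded_linear_mult_const bounded_linear_vec_nth)
  fix e :: real assume "e > 0"
  \<comment> \<open>The error \<open>e\<close> is shared equally among the coordinates.\<close>
  define e' where "e' = e / CARD('n)"
  have e': "e' > 0" using \<open>e > 0\<close> by (simp add: e'_def)
  have "\<forall>\<^sub>F y in nhds x. y \<in> S \<and> (\<forall>i\<in>UNIV. \<bar>d i y - d i x\<bar> < e')"
  proof (intro eventually_conj eventually_ball_finite ballI)
    show "\<forall>\<^sub>F y in nhds x. y \<in> S" using S by (rule eventually_nhds_in_open)
    fix i
    have "isCont (d i) x" using cont S by (metis continuous_on_eq_continuous_at)
    then have "(d i \<longlongrightarrow> d i x) (nhds x)" by (simp add: continuous_within tendsto_at_iff_tendsto_nhds)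
    from tendstoD[OF this e'] show "\<forall>\<^sub>F y in nhds x. \<bar>d i y - d i x\<bar> < e'" by (simp add: dist_real_def)
  qed simp
  then obtain \<delta> where \<delta>: "\<delta> > 0" "\<And>y. dist y x < \<delta> \<Longrightarrow> y \<in> S \<and> (\<forall>i. \<bar>d i y - d i x\<bar> < e')"
    unfolding eventually_nhds_metric by auto
  \<comment> \<open>Induction over the set \<open>A\<close> of coordinates already moved.\<close>
  have main: "\<bar>g (x + (\<Sum>i\<in>A. v $ i *\<^sub>R axis i 1)) - g x - (\<Sum>i\<in>A. v $ i * d i x)\<bar> \<le> card A * (e' * norm v)"
    if v: "norm v < \<delta>" and "finite A" for v :: "real ^ 'n" and A
    using \<open>finite A\<close>
  proof (induction A)
    case (insert i A)
    define y where "y = x + (\<Sum>i\<in>A. v $ i *\<^sub>R axis i 1)"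
    have comp: "(\<Sum>i\<in>A. v $ i *\<^sub>R axis i 1) $ j = (if j \<in> A then v $ j else 0)" for j
    proof -
      have "(\<Sum>i\<in>A. v $ i *\<^sub>R axis i 1) $ j = (\<Sum>i\<in>A. if j = i then v $ i else 0)"
        unfolding sum_component by (intro sum.cong) (auto simp: axis_def)
      then show ?thesis using insert.hyps by simp
    qed
    \<comment> \<open>No component of an intermediate displacement exceeds that of \<open>v\<close>
      in absolute value, so the whole path stays within \<delta> of \<open>x\<close>.\<close>
    have close: "dist (y + t *\<^sub>R axis i 1) x < \<delta>" if "\<bar>t\<bar> \<le> \<bar>v $ i\<bar>" for t
    proof -
      have "norm ((\<Sum>i\<in>A. v $ i *\<^sub>R axis i 1) + t *\<^sub>R axis i 1 :: real ^ 'n) \<le> norm v"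
      proof (rule norm_le_componentwise_cart)
        fix j
        show "norm (((\<Sum>i\<in>A. v $ i *\<^sub>R axis i 1) + t *\<^sub>R axis i 1 :: real ^ 'n) $ j) \<le> norm (v $ j)"
          using that insert.hyps unfolding vector_add_component comp by (auto simp: axis_def)
      qed
      then show ?thesis using v by (simp add: y_def dist_norm)
    qed
    have "\<exists>z. \<bar>z\<bar> \<le> \<bar>v $ i\<bar> \<and> g (y + (v $ i) *\<^sub>R axis i 1) - g (y + 0 *\<^sub>R axis i 1)
                 = v $ i * d i (y + z *\<^sub>R axis i 1)"
    proof (rule MVT_between)
      fix t assume t: "\<bar>t\<bar> \<le> \<bar>v $ i\<bar>"
      show "((\<lambda>h. g (y + h *\<^sub>R axis i 1)) has_real_derivative d i (y + t *\<^sub>R axis i 1)) (at t)"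
        by (rule partial_along_line, intro d) (use close[OF t] \<delta> in blast)
    qed
    then obtain z where z: "\<bar>z\<bar> \<le> \<bar>v $ i\<bar>"
      "g (y + (v $ i) *\<^sub>R axis i 1) - g y = v $ i * d i (y + z *\<^sub>R axis i 1)" by auto
    have "\<bar>g (y + (v $ i) *\<^sub>R axis i 1) - g y - v $ i * d i x\<bar>
        = \<bar>v $ i\<bar> * \<bar>d i (y + z *\<^sub>R axis i 1) - d i x\<bar>"
      unfolding z(2) by (simp add: algebra_simps flip: abs_mult)
    also have "\<dots> \<le> norm v * e'"
      using \<delta>(2)[OF close[OF z(1)]] component_le_norm_cart[of v i]
      by (intro mult_mono) (auto intro: less_imp_le)
    finally have "\<bar>g (y + (v $ i) *\<^sub>R axis i 1) - g y - v $ i * d i x\<bar> \<le> e' * norm v" by (simp add: mult.commute)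
    moreover have eqs: "x + (\<Sum>i\<in>insert i A. v $ i *\<^sub>R axis i 1) = y + (v $ i) *\<^sub>R axis i 1"
      "(\<Sum>i\<in>insert i A. v $ i * d i x) = v $ i * d i x + (\<Sum>i\<in>A. v $ i * d i x)"
      "real (card (insert i A)) * (e' * norm v) = e' * norm v + real (card A) * (e' * norm v)"
      using insert.hyps by (simp_all add: y_def algebra_simps)
    ultimately show ?case using insert.IH[folded y_def] unfolding eqs by linarith
  qed simp
  show "\<exists>\<delta>>0. \<forall>y. norm (y - x) < \<delta> \<longrightarrow>
      norm (g y - g x - (\<Sum>i\<in>UNIV. (y - x) $ i * d i x)) \<le> e * norm (y - x)"
  proof (intro exI[of _ \<delta>] conjI allI impI \<delta>(1))
    fix y assume "norm (y - x) < \<delta>"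
    moreover have "x + (\<Sum>i\<in>UNIV. (y - x) $ i *\<^sub>R axis i 1) = y"
      using basis_expansion[of "y - x"] by (simp add: scalar_mult_eq_scaleR)
    ultimately show "norm (g y - g x - (\<Sum>i\<in>UNIV. (y - x) $ i * d i x)) \<le> e * norm (y - x)"
      using main[of "y - x" UNIV] by (simp add: e'_def)
  qed
qed

text \<open>The mean value theorem is used in direction \<open>i\<close> on the difference \<phi> of
  \<open>g\<close> along two parallel lines, then in direction \<open>j\<close> on \<open>p\<close>.
  The second difference is symmetric in \<open>i\<close> and \<open>j\<close>, which is what makes
  mixed partials commute.\<close>

lemma second_difference:
  fixes g :: "real ^ 'n::finite \<Rightarrow> real"
  assumes S: "\<And>t u. \<bar>t\<bar> \<le> h \<Longrightarrow> \<bar>u\<bar> \<le> h \<Longrightarrow> x + t *\<^sub>R axis i 1 + u *\<^sub>R axis j 1 \<in> S" and h: "h \<ge> 0"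
    and p: "\<And>y. y \<in> S \<Longrightarrow> ((\<lambda>h. g (y + h *\<^sub>R axis i 1)) has_real_derivative p y) (at 0)"
    and q: "\<And>y. y \<in> S \<Longrightarrow> ((\<lambda>h. p (y + h *\<^sub>R axis j 1)) has_real_derivative q y) (at 0)"
  shows "\<exists>t u. \<bar>t\<bar> \<le> h \<and> \<bar>u\<bar> \<le> h \<and>
    g (x + h *\<^sub>R axis i 1 + h *\<^sub>R axis j 1) - g (x + h *\<^sub>R axis i 1) - g (x + h *\<^sub>R axis j 1) + g x
      = h * (h * q (x + t *\<^sub>R axis i 1 + u *\<^sub>R axis j 1))"
proof -
  define \<phi> where "\<phi> t = g ((x + h *\<^sub>R axis j 1) + t *\<^sub>R axis i 1) - g (x + t *\<^sub>R axis i 1)" for t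
  have "\<exists>t. \<bar>t\<bar> \<le> \<bar>h\<bar> \<and> \<phi> h - \<phi> 0 = h * (p ((x + h *\<^sub>R axis j 1) + t *\<^sub>R axis i 1) - p (x + t *\<^sub>R axis i 1))"
    unfolding \<phi>_def
  proof (rule MVT_between, rule DERIV_diff; rule partial_along_line, rule p)
    fix t assume "\<bar>t\<bar> \<le> \<bar>h\<bar>"
    then show "x + h *\<^sub>R axis j 1 + t *\<^sub>R axis i 1 \<in> S" "x + t *\<^sub>R axis i 1 \<in> S"
      using S[of t h] S[of t 0] h by (auto simp: algebra_simps)
  qed
  then obtain t where t: "\<bar>t\<bar> \<le> h"
    "\<phi> h - \<phi> 0 = h * (p ((x + t *\<^sub>R axis i 1) + h *\<^sub>R axis j 1) - p (x + t *\<^sub>R axis i 1))"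
    using h by (auto simp: algebra_simps)
  have "\<exists>u. \<bar>u\<bar> \<le> \<bar>h\<bar> \<and> p ((x + t *\<^sub>R axis i 1) + h *\<^sub>R axis j 1) - p ((x + t *\<^sub>R axis i 1) + 0 *\<^sub>R axis j 1)
      = h * q (x + t *\<^sub>R axis i 1 + u *\<^sub>R axis j 1)"
    by (rule MVT_between, rule partial_along_line, rule q) (use S t h in auto)
  then obtain u where u: "\<bar>u\<bar> \<le> h"
    "p ((x + t *\<^sub>R axis i 1) + h *\<^sub>R axis j 1) - p (x + t *\<^sub>R axis i 1)
      = h * q (x + t *\<^sub>R axis i 1 + u *\<^sub>R axis j 1)" using h by auto
  have "g (x + h *\<^sub>R axis i 1 + h *\<^sub>R axis j 1) - g (x + h *\<^sub>R axis i 1) - g (x + h *\<^sub>R axis j 1) + g x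
      = \<phi> h - \<phi> 0" by (simp add: \<phi>_def algebra_simps)
  then show ?thesis using t u by auto
qed

text \<open>Schwarz's theorem: one and the same second difference, divided by the squared step, is a
  value of \<open>q\<close> and a value of \<open>r\<close> at points close to
  \<open>x\<close>.\<close>

lemma mixed_partials_commute:
  fixes g :: "real ^ 'n::finite \<Rightarrow> real"
  assumes S: "open S" "x \<in> S"
    and p1: "\<And>y. y \<in> S \<Longrightarrow> ((\<lambda>h. g (y + h *\<^sub>R axis i 1)) has_real_derivative p1 y) (at 0)"
    and p2: "\<And>y. y \<in> S \<Longrightarrow> ((\<lambda>h. g (y + h *\<^sub>R axis j 1)) has_real_derivative p2 y) (at 0)"
    and q: "\<And>y. y \<in> S \<Longrightarrow> ((\<lambda>h. p1 (y + h *\<^sub>R axis j 1)) has_real_derivative q y) (at 0)"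
    and r: "\<And>y. y \<in> S \<Longrightarrow> ((\<lambda>h. p2 (y + h *\<^sub>R axis i 1)) has_real_derivative r y) (at 0)"
    and cont: "continuous_on S q" "continuous_on S r"
  shows "q x = r x"
proof (rule ccontr)
  assume ne: "q x \<noteq> r x"
  define e where "e = \<bar>q x - r x\<bar> / 2"
  have e: "e > 0" using ne by (simp add: e_def)
  have "isCont q x" "isCont r x" using cont S by (metis continuous_on_eq_continuous_at)+
  then have "(q \<longlongrightarrow> q x) (nhds x)" "(r \<longlongrightarrow> r x) (nhds x)"
    by (simp_all add: continuous_within tendsto_at_iff_tendsto_nhds)
  then have "\<forall>\<^sub>F y in nhds x. y \<in> S \<and> \<bar>q y - q x\<bar> < e \<and> \<bar>r y - r x\<bar> < e"
    using eventually_nhds_in_open[OF S] tendstoD[OF _ e, of q] tendstoD[OF _ e, of r]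
    by (simp add: eventually_conj_iff flip: dist_real_def)
  then obtain \<delta> where \<delta>: "\<delta> > 0" "\<And>y. dist y x < \<delta> \<Longrightarrow> y \<in> S \<and> \<bar>q y - q x\<bar> < e \<and> \<bar>r y - r x\<bar> < e"
    unfolding eventually_nhds_metric by auto
  \<comment> \<open>Two displacements of length at most \<open>h\<close> then stay within
    \<delta>.\<close>
  define h where "h = \<delta> / 3"
  have h: "h > 0" using \<delta> by (simp add: h_def)
  have close: "dist (x + t *\<^sub>R axis k 1 + u *\<^sub>R axis l 1) x < \<delta>" if "\<bar>t\<bar> \<le> h" "\<bar>u\<bar> \<le> h" for t u k l
  proof -
    have "norm (t *\<^sub>R axis k 1 + u *\<^sub>R axis l 1 :: real ^ 'n) \<le> \<bar>t\<bar> + \<bar>u\<bar>"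
      by (rule order.trans[OF norm_triangle_ineq]) simp
    also have "\<dots> < \<delta>" using that \<delta>(1) by (simp add: h_def)
    finally show ?thesis by (simp add: dist_norm add.assoc)
  qed
  then have inS: "x + t *\<^sub>R axis k 1 + u *\<^sub>R axis l 1 \<in> S" if "\<bar>t\<bar> \<le> h" "\<bar>u\<bar> \<le> h" for t u k l
    using \<delta>(2) that by blast
  obtain t u where tu: "\<bar>t\<bar> \<le> h" "\<bar>u\<bar> \<le> h"
    "g (x + h *\<^sub>R axis i 1 + h *\<^sub>R axis j 1) - g (x + h *\<^sub>R axis i 1) - g (x + h *\<^sub>R axis j 1) + g x
      = h * (h * q (x + t *\<^sub>R axis i 1 + u *\<^sub>R axis j 1))"
    using second_difference[OF inS less_imp_le[OF h] p1 q] by auto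
  obtain t' u' where tu': "\<bar>t'\<bar> \<le> h" "\<bar>u'\<bar> \<le> h"
    "g (x + h *\<^sub>R axis j 1 + h *\<^sub>R axis i 1) - g (x + h *\<^sub>R axis j 1) - g (x + h *\<^sub>R axis i 1) + g x
      = h * (h * r (x + t' *\<^sub>R axis j 1 + u' *\<^sub>R axis i 1))"
    using second_difference[OF inS less_imp_le[OF h] p2 r] by auto
  have "h * (h * q (x + t *\<^sub>R axis i 1 + u *\<^sub>R axis j 1)) = h * (h * r (x + t' *\<^sub>R axis j 1 + u' *\<^sub>R axis i 1))"
    unfolding tu(3)[symmetric] tu'(3)[symmetric] by (simp add: algebra_simps)
  then have "q (x + t *\<^sub>R axis i 1 + u *\<^sub>R axis j 1) = r (x + t' *\<^sub>R axis j 1 + u' *\<^sub>R axis i 1)"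
    using h by simp
  moreover have "\<bar>q (x + t *\<^sub>R axis i 1 + u *\<^sub>R axis j 1) - q x\<bar> < e"
    "\<bar>r (x + t' *\<^sub>R axis j 1 + u' *\<^sub>R axis i 1) - r x\<bar> < e"
    using close \<delta>(2) tu tu' by blast+
  ultimately have "\<bar>q x - r x\<bar> < 2 * e" by linarith
  then show False by (simp add: e_def)
qed

section \<open>Iterated partial derivatives, their boundary values and multi-indices\<close>

lemma iter_partial_Cons: "iter_partial (i # is) f = partial_deriv i (iter_partial is f)"
  by (simp add: iter_partial_def)

lemma iter_partial_has_derivative:
  assumes "smooth_on_ball f" "x \<in> ball 0 1"
  shows "((\<lambda>h. iter_partial is f (x + h *\<^sub>R axis i 1)) has_real_derivative iter_partial (i # is) f x) (at 0)"
  using assms unfolding smooth_on_ball_def iter_partial_Cons partial_deriv_def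
  by (auto simp: DERIV_deriv_iff_real_differentiable)

lemma continuous_on_iter_partial:
  assumes "smooth_on_ball f"
  shows "continuous_on (ball 0 1) (iter_partial is f)"
proof -
  obtain g where g: "continuous_on (cball 0 1) g" "\<forall>x\<in>ball 0 1. g x = iter_partial is f x"
    using assms unfolding smooth_on_ball_def by blast
  have "continuous_on (ball 0 1) g" by (rule continuous_on_subset[OF g(1)]) auto
  then show ?thesis by (rule continuous_on_eq) (use g(2) in auto)
qed

text \<open>Unlike \<open>multi_deriv\<close>, this keeps the given list of directions, the form in
  which the chain rule delivers derivatives. For smooth \<open>f\<close> the two agree.\<close>

definition ext_partial :: "'n list \<Rightarrow> (real ^ 'n::finite \<Rightarrow> real) \<Rightarrow> real ^ 'n \<Rightarrow> real" where
  "ext_partial is f x = Lim (at x within ball 0 1) (iter_partial is f)"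

text \<open>Every point of the closed ball is a limit point of the open ball, so the limit is unique
  and equals the continuous extension \<open>g\<close> supplied by smoothness.\<close>

lemma ext_partial:
  assumes "smooth_on_ball f"
  shows continuous_on_ext_partial: "continuous_on (cball 0 1) (ext_partial is f)"
    and ext_partial_eq: "\<And>x. x \<in> ball 0 1 \<Longrightarrow> ext_partial is f x = iter_partial is f x"
proof -
  obtain g where g: "continuous_on (cball 0 1) g" "\<forall>x\<in>ball 0 1. g x = iter_partial is f x"
    using assms unfolding smooth_on_ball_def by blast
  have eq: "ext_partial is f x = g x" if "x \<in> cball 0 1" for x
    unfolding ext_partial_def
  proof (rule tendsto_Lim)
    show "at x within ball 0 1 \<noteq> bot"
      using that by (simp add: trivial_limit_within islimpt_ball)
    have "(g \<longlongrightarrow> g x) (at x within ball 0 1)"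
      by (rule tendsto_within_subset[OF _ ball_subset_cball])
         (use g(1) that in \<open>simp add: continuous_on_def\<close>)
    then show "(iter_partial is f \<longlongrightarrow> g x) (at x within ball 0 1)"
      by (rule Lim_transform_within[where d=1]) (use g(2) in auto)
  qed
  then show "continuous_on (cball 0 1) (ext_partial is f)"
    by (intro continuous_on_eq[OF g(1)]) (simp add: eq)
  show "\<And>x. x \<in> ball 0 1 \<Longrightarrow> ext_partial is f x = iter_partial is f x" using eq g(2) by auto
qed

text \<open>Lets identities valid on the open ball be differentiated, as the inductions over
  direction lists require.\<close>

lemma partial_deriv_cong:
  assumes "open S" "x \<in> S" "\<And>y. y \<in> S \<Longrightarrow> g y = h y"
  shows "partial_deriv i g x = partial_deriv i h x"
  unfolding partial_deriv_def
proof (rule deriv_cong_ev)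
  have "((\<lambda>h. x + h *\<^sub>R axis i 1) \<longlongrightarrow> x + 0 *\<^sub>R axis i 1) (nhds (0::real))"
    by (intro tendsto_intros filterlim_ident)
  then have "\<forall>\<^sub>F t in nhds (0::real). x + t *\<^sub>R axis i 1 \<in> S"
    using topological_tendstoD assms(1,2) by fastforce
  then show "\<forall>\<^sub>F t in nhds 0. g (x + t *\<^sub>R axis i 1) = h (x + t *\<^sub>R axis i 1)"
    by eventually_elim (rule assms(3))
qed simp

lemma iter_partial_swap:
  assumes f: "smooth_on_ball f" and x: "x \<in> ball 0 1"
  shows "iter_partial (i # j # is) f x = iter_partial (j # i # is) f x"
  by (rule mixed_partials_commute[OF open_ball x])
     (rule iter_partial_has_derivative[OF f] continuous_on_iter_partial[OF f]; assumption)+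

lemma iter_partial_move:
  assumes f: "smooth_on_ball f" and x: "x \<in> ball 0 1"
  shows "iter_partial (xs @ a # ys) f x = iter_partial (a # xs @ ys) f x"
  using x
proof (induction xs arbitrary: x)
  case (Cons b xs)
  have "iter_partial ((b # xs) @ a # ys) f x = partial_deriv b (iter_partial (xs @ a # ys) f) x"
    by (simp add: iter_partial_Cons)
  also have "\<dots> = partial_deriv b (iter_partial (a # xs @ ys) f) x"
    by (rule partial_deriv_cong[OF open_ball Cons.prems]) (rule Cons.IH)
  also have "\<dots> = iter_partial (a # b # xs @ ys) f x"
    using iter_partial_swap[OF f Cons.prems, of b a "xs @ ys"] by (simp add: iter_partial_Cons)
  finally show ?case by simp
qed simp

text \<open>Adjacent swaps generate all permutations: the head of \<open>xs\<close> is located in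
  \<open>ys\<close> and moved to the front.\<close>

lemma iter_partial_perm:
  assumes f: "smooth_on_ball f" and x: "x \<in> ball 0 1" and "mset xs = mset ys"
  shows "iter_partial xs f x = iter_partial ys f x"
  using assms(2-)
proof (induction xs arbitrary: ys x)
  case (Cons a xs)
  then have "a \<in> set ys" by (metis list.set_intros(1) set_mset_mset)
  then obtain us vs where ys: "ys = us @ a # vs" by (meson split_list)
  have m: "mset xs = mset (us @ vs)" using Cons.prems by (simp add: ys)
  have "iter_partial (a # xs) f x = partial_deriv a (iter_partial (us @ vs) f) x"
    unfolding iter_partial_Cons
    by (rule partial_deriv_cong[OF open_ball Cons.prems(1)]) (rule Cons.IH[OF _ m])
  then show ?case using iter_partial_move[OF f Cons.prems(1)] by (simp add: ys iter_partial_Cons)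
qed simp

text \<open>The list chosen in \<open>multi_deriv\<close> is a permutation of \<open>is\<close>, so
  both limits are taken of functions that agree on the open ball.\<close>

lemma multi_deriv_eq_ext_partial:
  assumes f: "smooth_on_ball f" and x: "x \<in> cball 0 1"
  shows "multi_deriv (count_list is) f x = ext_partial is f x"
proof -
  define js where "js = (SOME js :: 'a list. \<forall>i. count_list js i = count_list is i)"
  have "\<forall>i. count_list js i = count_list is i" unfolding js_def by (rule someI[of _ "is"]) simp
  then have "mset js = mset is" by (intro multiset_eqI) (simp add: count_mset)
  then have "\<And>y. y \<in> ball 0 1 \<Longrightarrow> iter_partial js f y = iter_partial is f y"
    using iter_partial_perm[OF f] by blast
  then show ?thesis
    unfolding multi_deriv_def ext_partial_def js_def[symmetric]
    by (intro Lim_cong) (auto simp: eventually_at_filter)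
qed

lemma msize_count_list: "msize (count_list is) = length is"
  unfolding msize_def using sum_count_set[of "is" UNIV] by simp

lemma ex_count_list:
  fixes \<alpha> :: "'n::finite \<Rightarrow> nat"
  shows "\<exists>is. \<alpha> = count_list is"
proof -
  have "finite {x. \<alpha> x > 0}" by simp
  then obtain "is" where "mset is = Abs_multiset \<alpha>" using ex_mset by blast
  then show ?thesis by (intro exI[of _ "is"] ext) (simp add: count_mset[symmetric])
qed

lemma continuous_on_multi_deriv:
  fixes f :: "real ^ 'n::finite \<Rightarrow> real"
  assumes "smooth_on_ball f"
  shows "continuous_on (cball 0 1) (multi_deriv \<alpha> f)"
proof -
  obtain "is" where "\<alpha> = count_list is" using ex_count_list by blast
  then show ?thesis
    by (intro continuous_on_eq[OF continuous_on_ext_partial[OF assms, of "is"]])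
       (simp add: multi_deriv_eq_ext_partial[OF assms])
qed

text \<open>A sum over an infinite set would be 0 by default, so finiteness gives the sums over
  multi-indices their meaning.\<close>

lemma finite_msize: "finite {\<alpha> :: 'n::finite \<Rightarrow> nat. msize \<alpha> \<in> {a..b}}"
proof (rule finite_subset)
  show "{\<alpha> :: 'n \<Rightarrow> nat. msize \<alpha> \<in> {a..b}} \<subseteq> PiE UNIV (\<lambda>_. {..b})"
  proof (clarsimp simp: PiE_iff)
    fix \<alpha> :: "'n \<Rightarrow> nat" assume "msize \<alpha> \<le> b"
    then show "\<alpha> i \<le> b" for i unfolding msize_def using member_le_sum[of i UNIV \<alpha>] by auto
  qed
qed (auto intro!: finite_PiE)

section \<open>Interpolation and the higher chain rule\<close>

definition lagrange_basis :: "real set \<Rightarrow> real \<Rightarrow> real poly" where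
  "lagrange_basis A a = (\<Prod>b\<in>A - {a}. smult (1 / (a - b)) [:- b, 1:])"

lemma poly_lagrange_basis:
  assumes "finite A" "a \<in> A" "b \<in> A"
  shows "poly (lagrange_basis A a) b = (if a = b then 1 else 0)"
proof (cases "a = b")
  case True
  then show ?thesis using assms
    by (auto simp: lagrange_basis_def poly_prod divide_simps intro!: prod.neutral)
next
  case False
  then show ?thesis using assms by (auto simp: lagrange_basis_def poly_prod)
qed

lemma degree_lagrange_basis:
  assumes "finite A" "a \<in> A"
  shows "degree (lagrange_basis A a) < card A"
proof -
  have "degree (lagrange_basis A a) \<le> (\<Sum>b\<in>A - {a}. degree (smult (1 / (a - b)) [:- b, 1:]))"
    unfolding lagrange_basis_def using assms by (intro degree_prod_sum_le[unfolded o_def]) auto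
  also have "\<dots> \<le> (\<Sum>b\<in>A - {a}. 1)" by (intro sum_mono) (auto intro: order.trans[OF degree_smult_le])
  also have "\<dots> = card (A - {a})" by simp
  also have "\<dots> < card A" by (rule card_Diff1_less[OF assms])
  finally show ?thesis .
qed

lemma higher_pderiv_eq_0: "degree p < k \<Longrightarrow> (pderiv ^^ k) (p :: real poly) = 0"
  by (intro poly_eqI) (simp add: coeff_higher_pderiv coeff_eq_0)

lemma higher_pderiv_monic:
  fixes p :: "real poly"
  assumes "lead_coeff p = 1" "degree p = k"
  shows "(pderiv ^^ k) p = [:fact k:]"
proof (intro poly_eqI)
  fix j show "coeff ((pderiv ^^ k) p) j = coeff [:fact k:] j"
    using assms by (cases j) (auto simp: coeff_higher_pderiv pochhammer_fact coeff_eq_0)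
qed

text \<open>The interpolation error formula: a multiple of the node polynomial \<open>w\<close>
  corrects \<open>L\<close> at \<open>t\<close>, and Rolle's theorem with \<open>D + 1\<close> zeros
  identifies the multiple as a value of \<open>h D\<close> over \<open>D!\<close>. The node values
  stay in the bound because on the shrunken curve they need not vanish.\<close>

lemma interpolation_bound:
  fixes h :: "nat \<Rightarrow> real \<Rightarrow> real"
  assumes h: "\<And>k x. x \<in> {-1..1} \<Longrightarrow> (h k has_real_derivative h (Suc k) x) (at x)"
    and A: "finite A" "A \<subseteq> {-1..1}" "card A = D"
    and K: "\<And>x. x \<in> {-1..1} \<Longrightarrow> \<bar>h D x\<bar> \<le> K"
    and t: "t \<in> {-1..1}"
  shows "\<bar>h 0 t\<bar> \<le> (\<Sum>a\<in>A. \<bar>h 0 a\<bar> * \<bar>poly (lagrange_basis A a) t\<bar>) + K * 2 ^ D / fact D"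
proof (cases "t \<in> A")
  case True
  have "\<bar>h 0 t\<bar> = \<bar>h 0 t\<bar> * \<bar>poly (lagrange_basis A t) t\<bar>" using poly_lagrange_basis[of A t t] A True by simp
  also have "\<dots> \<le> (\<Sum>a\<in>A. \<bar>h 0 a\<bar> * \<bar>poly (lagrange_basis A a) t\<bar>)"
    using A True by (intro member_le_sum) auto
  moreover have "0 \<le> K * 2 ^ D / fact D" using K[OF t] by simp
  ultimately show ?thesis by linarith
next
  case False
  define w where "w = (\<Prod>b\<in>A. [:- b, 1::real:])"
  define L where "L = (\<Sum>a\<in>A. smult (h 0 a) (lagrange_basis A a))"
  \<comment> \<open>Chosen so that \<open>q\<close> agrees with \<open>h 0\<close> at
    \<open>t\<close> as well as at the nodes.\<close>
  define \<kappa> where "\<kappa> = (h 0 t - poly L t) / poly w t"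
  define q where "q = L + smult \<kappa> w"
  have wt: "poly w t \<noteq> 0" using A False by (auto simp: w_def poly_prod)
  have w0: "poly w a = 0" if "a \<in> A" for a using A that by (auto simp: w_def poly_prod)
  have La: "poly L a = h 0 a" if "a \<in> A" for a
    unfolding L_def poly_sum poly_smult using A that
    by (simp add: poly_lagrange_basis if_distrib[of "\<lambda>x. _ * x"] cong: if_cong)
  have "\<exists>x\<in>{-1..1}. h D x - poly ((pderiv ^^ D) q) x = 0"
  proof (rule iterated_Rolle[where A = "insert t A" and h = "\<lambda>k x. h k x - poly ((pderiv ^^ k) q) x"])
    show "((\<lambda>x. h k x - poly ((pderiv ^^ k) q) x) has_real_derivative
            h (Suc k) x - poly ((pderiv ^^ Suc k) q) x) (at x)" if "x \<in> {-1..1}" for k x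
      using h[OF that] by (auto intro!: derivative_eq_intros)
    show "h 0 x - poly ((pderiv ^^ 0) q) x = 0" if "x \<in> insert t A" for x
      using that wt w0 La by (auto simp: q_def \<kappa>_def)
  qed (use A False t in auto)
  then obtain x where x: "x \<in> {-1..1}" "h D x = poly ((pderiv ^^ D) q) x" by auto
  have "lead_coeff w = 1" unfolding w_def by (simp add: lead_coeff_prod)
  moreover have "degree w = D" unfolding w_def using A by (subst degree_prod_eq_sum_degree) auto
  ultimately have w_D: "(pderiv ^^ D) w = [:fact D:]" by (rule higher_pderiv_monic)
  have "(pderiv ^^ D) L = 0" unfolding L_def higher_pderiv_sum higher_pderiv_smult
    using A(3) degree_lagrange_basis[OF A(1)] by (intro sum.neutral ballI) (simp add: higher_pderiv_eq_0)
  then have "h D x = \<kappa> * fact D" unfolding x(2) q_def by (simp add: higher_pderiv_add higher_pderiv_smult w_D)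
  then have \<kappa>: "\<bar>\<kappa>\<bar> \<le> K / fact D" using K[OF x(1)] by (simp add: abs_mult pos_le_divide_eq)
  have "\<bar>poly w t\<bar> = (\<Prod>b\<in>A. \<bar>t - b\<bar>)" by (simp add: w_def poly_prod abs_prod)
  \<comment> \<open>Two points of [-1, 1] are at distance at most 2, which is the source of the
    power of 2.\<close>
  also have "\<dots> \<le> (\<Prod>b\<in>A. 2)" using A t by (intro prod_mono) fastforce
  finally have w2: "\<bar>poly w t\<bar> \<le> 2 ^ D" using A by simp
  have "\<bar>h 0 t - poly L t\<bar> = \<bar>\<kappa>\<bar> * \<bar>poly w t\<bar>" using wt by (simp add: \<kappa>_def abs_divide)
  also have "\<dots> \<le> K / fact D * 2 ^ D" using \<kappa> w2 by (intro mult_mono) (auto intro: order.trans[OF abs_ge_zero])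
  finally have "\<bar>h 0 t\<bar> \<le> \<bar>poly L t\<bar> + K * 2 ^ D / fact D" by simp
  moreover have "\<bar>poly L t\<bar> \<le> (\<Sum>a\<in>A. \<bar>h 0 a\<bar> * \<bar>poly (lagrange_basis A a) t\<bar>)"
    unfolding L_def poly_sum poly_smult abs_mult[symmetric] by (rule sum_abs)
  ultimately show ?thesis by linarith
qed

section \<open>The higher chain rule along a polynomial curve\<close>

text \<open>A list of pairs \<open>(i, m)\<close> encodes a term of a derivative of \<open>f \<circ> \<omega>\<close>: the partial derivative
  of \<open>f\<close> in all the directions \<open>i\<close>, times the product of the \<open>m\<close>-th derivatives of the
  \<open>\<omega>\<^sub>i\<close>. Differentiating raises one of the \<open>m\<close> or adds a pair \<open>(i, 1)\<close>.\<close>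

fun bumps :: "('n \<times> nat) list \<Rightarrow> ('n \<times> nat) list list" where
  "bumps [] = []"
| "bumps ((i, m) # T) = ((i, Suc m) # T) # map (Cons (i, m)) (bumps T)"

text \<open>The index type carries no order; any fixed enumeration serves, since only the sum over
  all directions matters.\<close>

definition directions :: "'n::finite list" where
  "directions = (SOME xs. set xs = UNIV \<and> distinct xs)"

text \<open>Equal terms remain separate entries, so no multiplicities occur and the length of the
  list counts the terms.\<close>

fun chain_terms :: "nat \<Rightarrow> ('n::finite \<times> nat) list list" where
  "chain_terms 0 = [[]]"
| "chain_terms (Suc k) = concat (map (\<lambda>T. map (\<lambda>i. (i, 1) # T) directions @ bumps T) (chain_terms k))"

definition curve_factor :: "('n \<Rightarrow> real poly) \<Rightarrow> ('n \<times> nat) list \<Rightarrow> real \<Rightarrow> real" where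
  "curve_factor P T t = (\<Prod>(i, m)\<leftarrow>T. poly ((pderiv ^^ m) (P i)) t)"

definition poly_curve :: "('n::finite \<Rightarrow> real poly) \<Rightarrow> real \<Rightarrow> real ^ 'n" where
  "poly_curve P t = (\<chi> i. poly (P i) t)"

definition chain_value ::
  "(real ^ 'n \<Rightarrow> real) \<Rightarrow> ('n::finite \<Rightarrow> real poly) \<Rightarrow> ('n \<times> nat) list \<Rightarrow> real \<Rightarrow> real" where
  "chain_value f P T t = iter_partial (map fst T) f (poly_curve P t) * curve_factor P T t"

lemma directions: "set (directions :: 'n::finite list) = UNIV" "distinct (directions :: 'n list)"
  using someI_ex[OF finite_distinct_list[OF finite, of "UNIV :: 'n set"]] by (simp_all add: directions_def)

lemma length_directions: "length (directions :: 'n::finite list) = CARD('n)"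
  using distinct_card[of "directions :: 'n list"] by (simp add: directions)

lemma length_bumps: "length (bumps T) = length T"
  by (induction T rule: bumps.induct) auto

lemma bumps_props:
  "U \<in> set (bumps T) \<Longrightarrow> map fst U = map fst T \<and> sum_list (map snd U) = Suc (sum_list (map snd T))"
  by (induction T arbitrary: U rule: bumps.induct) auto

text \<open>The length is the order of the partial derivative of \<open>f\<close>, and the second
  components distribute the \<open>k\<close> differentiations over the components of the
  curve.\<close>

lemma chain_terms_props:
  "T \<in> set (chain_terms k) \<Longrightarrow> length T \<le> k \<and> sum_list (map snd T) = k"
proof (induction k arbitrary: T)
  case (Suc k)
  then obtain U where U: "U \<in> set (chain_terms k)"
    "T \<in> (\<lambda>i. (i, 1) # U) ` set directions \<or> T \<in> set (bumps U)" by auto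
  then show ?case using Suc.IH[OF U(1)] bumps_props[of T U] map_eq_imp_length_eq[of fst T fst U] by auto
qed simp

text \<open>A term has one successor per direction and one per pair, hence at most
  \<open>CARD('n) + k\<close> of them.\<close>

lemma length_chain_terms:
  "length (chain_terms k :: ('n::finite \<times> nat) list list) \<le> (CARD('n) + k) ^ k"
proof (induction k)
  case (Suc k)
  have "length (chain_terms (Suc k) :: ('n \<times> nat) list list)
      = (\<Sum>T\<leftarrow>(chain_terms k :: ('n \<times> nat) list list). CARD('n) + length T)"
    by (simp add: length_concat length_directions length_bumps o_def)
  also have "\<dots> \<le> (\<Sum>T\<leftarrow>(chain_terms k :: ('n \<times> nat) list list). CARD('n) + k)"
    by (intro sum_list_mono) (simp add: chain_terms_props)
  also have "\<dots> = length (chain_terms k :: ('n \<times> nat) list list) * (CARD('n) + k)"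
    by (simp add: sum_list_triv)
  also have "\<dots> \<le> (CARD('n) + Suc k) ^ k * (CARD('n) + Suc k)"
    by (intro mult_mono order.trans[OF Suc power_mono]) auto
  finally show ?case by (simp add: mult.commute)
qed simp

lemma curve_factor_has_derivative:
  "(curve_factor P T has_real_derivative (\<Sum>U\<leftarrow>bumps T. curve_factor P U t)) (at t)"
proof (induction T rule: bumps.induct)
  case 1
  then show ?case by (simp add: curve_factor_def)
next
  case (2 i m T)
  have "curve_factor P ((i, m) # T) = (\<lambda>t. poly ((pderiv ^^ m) (P i)) t * curve_factor P T t)"
    by (simp add: curve_factor_def fun_eq_iff)
  moreover have "(\<Sum>U\<leftarrow>bumps ((i, m) # T). curve_factor P U t)
      = poly ((pderiv ^^ Suc m) (P i)) t * curve_factor P T t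
        + poly ((pderiv ^^ m) (P i)) t * (\<Sum>U\<leftarrow>bumps T. curve_factor P U t)"
    by (simp add: curve_factor_def o_def sum_list_const_mult)
  ultimately show ?case using DERIV_mult[OF poly_DERIV 2, of "(pderiv ^^ m) (P i)"]
    by (simp add: mult.commute add.commute)
qed

lemma poly_curve_has_derivative:
  "(poly_curve P has_derivative (\<lambda>h. \<chi> i. h * poly (pderiv (P i)) t)) (at t)"
proof -
  have D: "(poly p has_derivative (\<lambda>h. h * poly (pderiv p) t)) (at t)" for p :: "real poly"
    using poly_DERIV[of p t] unfolding has_field_derivative_def mult_commute_abs .
  have "((\<lambda>t. \<Sum>i\<in>UNIV. poly (P i) t *\<^sub>R axis i (1::real)) has_derivative
      (\<lambda>h. \<Sum>i\<in>UNIV. (h * poly (pderiv (P i)) t) *\<^sub>R axis i 1)) (at t)"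
    by (intro has_derivative_sum has_derivative_scaleR_left D)
  moreover have "(\<Sum>i\<in>UNIV. v i *\<^sub>R axis i (1::real)) = (\<chi> i. v i)" for v :: "'a \<Rightarrow> real"
    using basis_expansion[of "\<chi> i. v i"] by (simp add: scalar_mult_eq_scaleR)
  ultimately show ?thesis by (simp add: poly_curve_def[abs_def])
qed

lemma chain_value_has_derivative:
  fixes f :: "real ^ 'n::finite \<Rightarrow> real"
  assumes f: "smooth_on_ball f" and t: "poly_curve P t \<in> ball 0 1"
  shows "(chain_value f P T has_real_derivative
           (\<Sum>U\<leftarrow>map (\<lambda>i. (i, 1) # T) directions @ bumps T. chain_value f P U t)) (at t)"
proof -
  define g where "g = iter_partial (map fst T) f"
  define d where "d i = iter_partial (i # map fst T) f" for i
  have "(g has_derivative (\<lambda>v. \<Sum>i\<in>UNIV. v $ i * d i (poly_curve P t))) (at (poly_curve P t))"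
    unfolding g_def d_def
    by (rule has_derivative_of_partials[OF open_ball t])
       (auto intro: iter_partial_has_derivative[OF f] continuous_on_iter_partial[OF f])
  note H = has_derivative_compose[OF poly_curve_has_derivative this]
  have "((\<lambda>t. g (poly_curve P t)) has_real_derivative
      (\<Sum>i\<in>UNIV. poly (pderiv (P i)) t * d i (poly_curve P t))) (at t)"
    unfolding has_field_derivative_def
    by (rule has_derivative_eq_rhs[OF H]) (simp add: fun_eq_iff sum_distrib_left sum_distrib_right mult_ac)
  from DERIV_mult[OF this curve_factor_has_derivative[of P T]]
  have "(chain_value f P T has_real_derivative
      (\<Sum>i\<in>UNIV. poly (pderiv (P i)) t * d i (poly_curve P t)) * curve_factor P T t
       + (\<Sum>U\<leftarrow>bumps T. curve_factor P U t) * g (poly_curve P t)) (at t)"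
    by (simp add: chain_value_def[abs_def] g_def)
  moreover have "(\<Sum>U\<leftarrow>map (\<lambda>i. (i, 1) # T) directions. chain_value f P U t)
      = (\<Sum>i\<in>UNIV. poly (pderiv (P i)) t * d i (poly_curve P t)) * curve_factor P T t"
    unfolding sum_distrib_right
    by (simp add: o_def sum_list_distinct_conv_sum_set directions chain_value_def d_def curve_factor_def algebra_simps)
  moreover have "(\<Sum>U\<leftarrow>bumps T. chain_value f P U t)
      = (\<Sum>U\<leftarrow>bumps T. curve_factor P U t) * g (poly_curve P t)"
  proof -
    \<comment> \<open>Bumping leaves the directions alone, so the partial derivative of
      \<open>f\<close> is a common factor.\<close>
    have "map (\<lambda>U. chain_value f P U t) (bumps T)
        = map (\<lambda>U. curve_factor P U t * g (poly_curve P t)) (bumps T)"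
      using bumps_props[of _ T] by (auto simp: chain_value_def g_def)
    then show ?thesis by (simp only: sum_list_mult_const)
  qed
  ultimately show ?thesis by (simp only: map_append sum_list_append)
qed

lemma chain_rule_higher:
  fixes f :: "real ^ 'n::finite \<Rightarrow> real"
  assumes f: "smooth_on_ball f" and t: "poly_curve P t \<in> ball 0 1"
  shows "((\<lambda>t. \<Sum>T\<leftarrow>chain_terms k. chain_value f P T t) has_real_derivative
           (\<Sum>T\<leftarrow>chain_terms (Suc k). chain_value f P T t)) (at t)"
proof -
  have "((\<lambda>t. \<Sum>T\<leftarrow>Ts. chain_value f P T t) has_real_derivative
      (\<Sum>T\<leftarrow>concat (map (\<lambda>T. map (\<lambda>i. (i, 1) # T) directions @ bumps T) Ts). chain_value f P T t)) (at t)"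
    for Ts
  proof (induction Ts)
    case (Cons T Ts)
    from DERIV_add[OF chain_value_has_derivative[OF f t, of T] Cons] show ?case by (simp add: add.assoc)
  qed simp
  then show ?thesis by simp
qed

text \<open>The first bound multiplies \<open>Markov_higher\<close> over the pairs. The second holds
  because differentiating more than \<open>s\<close> times annihilates a component, so each pair of
  a nonzero product contributes at most \<open>s\<close>.\<close>

lemma curve_factor_bound:
  fixes P :: "'n \<Rightarrow> real poly"
  assumes deg: "\<And>i. degree (P i) \<le> s" and s: "s \<ge> 1"
    and P: "\<And>i t. t \<in> {-1..1} \<Longrightarrow> \<bar>poly (P i) t\<bar> \<le> 1" and t: "t \<in> {-1..1}"
  shows "\<bar>curve_factor P T t\<bar> \<le> (2 * real s ^ 2) ^ sum_list (map snd T)"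
    and "curve_factor P T t \<noteq> 0 \<Longrightarrow> sum_list (map snd T) \<le> s * length T"
proof -
  show "\<bar>curve_factor P T t\<bar> \<le> (2 * real s ^ 2) ^ sum_list (map snd T)"
  proof (induction T)
    case (Cons x T)
    have "\<bar>curve_factor P (x # T) t\<bar> = \<bar>poly ((pderiv ^^ snd x) (P (fst x))) t\<bar> * \<bar>curve_factor P T t\<bar>"
      by (simp add: curve_factor_def abs_mult split_beta)
    also have "\<dots> \<le> (2 * real s ^ 2) ^ snd x * (2 * real s ^ 2) ^ sum_list (map snd T)"
      using Cons Markov_higher[OF deg s P t] by (intro mult_mono) auto
    finally show ?case by (simp add: power_add)
  qed (simp add: curve_factor_def)
  show "sum_list (map snd T) \<le> s * length T" if "curve_factor P T t \<noteq> 0"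
    using that
  proof (induction T)
    case (Cons x T)
    then have nz: "poly ((pderiv ^^ snd x) (P (fst x))) t \<noteq> 0" "curve_factor P T t \<noteq> 0"
      by (auto simp: curve_factor_def split_beta)
    have "snd x \<le> s"
    proof (rule ccontr)
      assume "\<not> snd x \<le> s"
      then have "degree (P (fst x)) < snd x" using deg[of "fst x"] by linarith
      then show False using nz(1) by (simp add: higher_pderiv_eq_0)
    qed
    then show ?case using Cons.IH[OF nz(2)] by simp
  qed simp
qed

text \<open>Terms with vanishing curve factor drop out, so \<open>M\<close> has to control only
  orders between \<open>k / s\<close> and \<open>k\<close>.\<close>

lemma chain_sum_bound:
  fixes f :: "real ^ 'n::finite \<Rightarrow> real"
  assumes deg: "\<And>i. degree (P i) \<le> s" and s: "s \<ge> 1"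
    and P: "\<And>i t. t \<in> {-1..1} \<Longrightarrow> \<bar>poly (P i) t\<bar> \<le> 1" and t: "t \<in> {-1..1}"
    and M: "M \<ge> 0" "\<And>is. length is \<le> k \<Longrightarrow> k \<le> s * length is \<Longrightarrow> \<bar>iter_partial is f (poly_curve P t)\<bar> \<le> M"
  shows "\<bar>\<Sum>T\<leftarrow>chain_terms k. chain_value f P T t\<bar> \<le> real (CARD('n) + k) ^ k * (M * (2 * real s ^ 2) ^ k)"
proof -
  have term_le: "\<bar>chain_value f P T t\<bar> \<le> M * (2 * real s ^ 2) ^ k" if T: "T \<in> set (chain_terms k)" for T
  proof (cases "curve_factor P T t = 0")
    case True
    then show ?thesis using M(1) by (simp add: chain_value_def)
  next
    case False
    have B: "\<bar>curve_factor P T t\<bar> \<le> (2 * real s ^ 2) ^ sum_list (map snd T)"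
      "curve_factor P T t \<noteq> 0 \<Longrightarrow> sum_list (map snd T) \<le> s * length T"
      by (rule curve_factor_bound; use deg s P t in blast)+
    have "k \<le> s * length T" using B(2)[OF False] chain_terms_props[OF T] by simp
    then have "\<bar>iter_partial (map fst T) f (poly_curve P t)\<bar> \<le> M" using chain_terms_props[OF T] by (intro M(2)) auto
    then show ?thesis unfolding chain_value_def abs_mult
      using B(1) chain_terms_props[OF T] M(1) by (intro mult_mono) auto
  qed
  have "\<bar>\<Sum>T\<leftarrow>chain_terms k. chain_value f P T t\<bar> \<le> (\<Sum>T\<leftarrow>chain_terms k. \<bar>chain_value f P T t\<bar>)"
    using sum_list_abs[of "map (\<lambda>T. chain_value f P T t) (chain_terms k)"] by (simp add: o_def)
  also have "\<dots> \<le> (\<Sum>T\<leftarrow>(chain_terms k :: ('n \<times> nat) list list). M * (2 * real s ^ 2) ^ k)"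
    by (intro sum_list_mono term_le)
  also have "\<dots> = real (length (chain_terms k :: ('n \<times> nat) list list)) * (M * (2 * real s ^ 2) ^ k)"
    by (simp add: sum_list_triv)
  also have "\<dots> \<le> real ((CARD('n) + k) ^ k) * (M * (2 * real s ^ 2) ^ k)"
    using M(1) length_chain_terms[where 'n = 'n, of k] by (intro mult_right_mono) (auto simp del: of_nat_power)
  finally show ?thesis by simp
qed

section \<open>The estimate along the curve\<close>

lemma continuous_on_poly_curve: "continuous_on S (poly_curve P)"
  unfolding poly_curve_def by (intro continuous_on_vec_lambda continuous_on_poly continuous_on_id)

lemma scaleR_in_ball:
  fixes x :: "'a::real_normed_vector"
  assumes "0 < r" "r < 1" "x \<in> cball 0 1"
  shows "r *\<^sub>R x \<in> ball 0 1"
proof -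
  have "r * norm x \<le> r * 1" using assms by (intro mult_left_mono) auto
  also have "\<dots> < 1" using assms by simp
  finally show ?thesis using assms by simp
qed

text \<open>Uniform continuity on the compact ball yields one range of \<open>r\<close> valid for
  all \<open>t\<close>, carrying bounds from the curve to its shrunken copies.\<close>

lemma ext_partial_near:
  fixes f :: "real ^ 'n::finite \<Rightarrow> real"
  assumes f: "smooth_on_ball f" and c: "\<And>t. t \<in> S \<Longrightarrow> c t \<in> cball 0 1" and e: "e > 0"
  shows "\<forall>\<^sub>F r in at_left 1. \<forall>t\<in>S. \<bar>iter_partial is f (r *\<^sub>R c t)\<bar> \<le> \<bar>ext_partial is f (c t)\<bar> + e"
proof -
  have "uniformly_continuous_on (cball 0 1) (ext_partial is f)"
    by (intro compact_uniformly_continuous continuous_on_ext_partial f compact_cball)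
  then obtain \<delta> where \<delta>: "\<delta> > 0"
    "\<And>x y. x \<in> cball 0 1 \<Longrightarrow> y \<in> cball 0 1 \<Longrightarrow> dist y x < \<delta> \<Longrightarrow> dist (ext_partial is f y) (ext_partial is f x) < e"
    using e unfolding uniformly_continuous_on_def by metis
  have "\<forall>\<^sub>F r in at_left 1. r \<in> {max 0 (1 - \<delta>)<..<1::real}"
    using \<delta>(1) by (intro eventually_at_leftI[of "max 0 (1 - \<delta>)"]) auto
  then show ?thesis
  proof eventually_elim
    case (elim r)
    show ?case
    proof
      fix t assume t: "t \<in> S"
      have n: "norm (c t) \<le> 1" using c[OF t] by simp
      have b: "r *\<^sub>R c t \<in> ball 0 1" using elim c[OF t] by (intro scaleR_in_ball) auto
      have "dist (r *\<^sub>R c t) (c t) = norm ((r - 1) *\<^sub>R c t)" by (simp add: dist_norm algebra_simps)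
      also have "\<dots> \<le> (1 - r) * 1" unfolding norm_scaleR using elim n by (intro mult_mono) auto
      also have "\<dots> < \<delta>" using elim by simp
      finally have "\<bar>ext_partial is f (r *\<^sub>R c t) - ext_partial is f (c t)\<bar> < e"
        using \<delta>(2)[of "c t" "r *\<^sub>R c t"] c[OF t] b ball_subset_cball by (auto simp: dist_real_def)
      then show "\<bar>iter_partial is f (r *\<^sub>R c t)\<bar> \<le> \<bar>ext_partial is f (c t)\<bar> + e"
        using ext_partial_eq[OF f b] by simp
    qed
  qed
qed

text \<open>The curve may touch the sphere, where \<open>f\<close> has no derivatives in the strict sense. The
  estimate is therefore made for the shrunken curve \<open>r \<omega>\<close>, whose values at the zeros of
  \<open>f \<circ> \<omega>\<close> tend to zero as \<open>r\<close> tends to \<open>1\<close>.\<close>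

lemma curve_value_bound:
  fixes f :: "real ^ 'n::finite \<Rightarrow> real"
  assumes f: "smooth_on_ball f" and deg: "\<And>i. degree (P i) \<le> s" and s: "s \<ge> 1"
    and c: "\<And>t. t \<in> {-1..1} \<Longrightarrow> poly_curve P t \<in> cball 0 1"
    and inf: "infinite {t \<in> {-1..1}. f (poly_curve P t) = 0}"
    and M: "\<And>is t. t \<in> {-1..1} \<Longrightarrow> length is \<le> D \<Longrightarrow> D \<le> s * length is
                   \<Longrightarrow> \<bar>ext_partial is f (poly_curve P t)\<bar> \<le> M" and "M \<ge> 0"
    and t: "t \<in> {-1..1}"
  shows "\<bar>f (poly_curve P t)\<bar> \<le> real (CARD('n) + D) ^ D * (2 * real s ^ 2) ^ D * 2 ^ D / fact D * M"
proof -
  define B where "B = real (CARD('n) + D) ^ D * (2 * real s ^ 2) ^ D * 2 ^ D / fact D"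
  have B: "B > 0" using s by (auto simp: B_def intro!: divide_pos_pos mult_pos_pos zero_less_power add_pos_nonneg)
  \<comment> \<open>The components of the shrunken curve; for \<open>r\<close> between 0 and 1 the
    bounds on degree and size persist.\<close>
  define Q where "Q r i = smult r (P i)" for r i
  have Q: "poly_curve (Q r) u = r *\<^sub>R poly_curve P u" for r u
    by (simp add: poly_curve_def Q_def vec_eq_iff)
  obtain A where A: "finite A" "card A = D" "A \<subseteq> {t \<in> {-1..1}. f (poly_curve P t) = 0}"
    using infinite_arbitrarily_large[OF inf] by metis
  have coord: "\<bar>poly (P i) u\<bar> \<le> 1" if "u \<in> {-1..1}" for i u
    using component_le_norm_cart[of "poly_curve P u" i] c[OF that] by (simp add: poly_curve_def)
  \<comment> \<open>The slack \<open>M' - M\<close> absorbs the error of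
    \<open>ext_partial_near\<close> and is removed at the end by letting \<open>M'\<close> decrease
    to \<open>M\<close>.\<close>
  have "\<bar>f (poly_curve P t)\<bar> \<le> B * M'" if "M' > M" for M'
  proof -
    \<comment> \<open>Only finitely many direction lists have length at most \<open>D\<close>, so
      all \<open>r\<close> close enough to 1 serve them all.\<close>
    have "\<forall>\<^sub>F r in at_left 1. \<forall>is\<in>{is. set is \<subseteq> UNIV \<and> length is \<le> D}. \<forall>u\<in>{-1..1}.
        \<bar>iter_partial is f (r *\<^sub>R poly_curve P u)\<bar> \<le> \<bar>ext_partial is f (poly_curve P u)\<bar> + (M' - M)"
      using that by (intro eventually_ball_finite finite_lists_length_le ballI ext_partial_near f c) auto
    moreover have "\<forall>\<^sub>F r in at_left 1. r \<in> {0<..<1::real}"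
      by (intro eventually_at_leftI[of 0]) auto
    ultimately have "\<forall>\<^sub>F r in at_left 1. \<bar>f (r *\<^sub>R poly_curve P t)\<bar>
      \<le> (\<Sum>a\<in>A. \<bar>f (r *\<^sub>R poly_curve P a)\<bar> * \<bar>poly (lagrange_basis A a) t\<bar>) + B * M'"
    proof eventually_elim
      case (elim r)
      define h where "h k x = (\<Sum>T\<leftarrow>chain_terms k. chain_value f (Q r) T x)" for k x
      have h0: "h 0 x = f (r *\<^sub>R poly_curve P x)" for x
        by (simp add: h_def chain_value_def curve_factor_def Q iter_partial_def)
      have "\<bar>h 0 t\<bar> \<le> (\<Sum>a\<in>A. \<bar>h 0 a\<bar> * \<bar>poly (lagrange_basis A a) t\<bar>)
          + real (CARD('n) + D) ^ D * (M' * (2 * real s ^ 2) ^ D) * 2 ^ D / fact D"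
      proof (rule interpolation_bound)
        show "(h k has_real_derivative h (Suc k) x) (at x)" if x: "x \<in> {-1..1}" for k x
        proof -
          have "poly_curve (Q r) x \<in> ball 0 1"
            unfolding Q using elim(2) by (intro scaleR_in_ball c x) auto
          from chain_rule_higher[OF f this] show ?thesis by (simp add: h_def[abs_def])
        qed
        show "\<bar>h D x\<bar> \<le> real (CARD('n) + D) ^ D * (M' * (2 * real s ^ 2) ^ D)" if x: "x \<in> {-1..1}" for x
          unfolding h_def
        proof (rule chain_sum_bound[OF _ s])
          show "degree (Q r i) \<le> s" for i using deg[of i] by (simp add: Q_def)
          show "\<bar>poly (Q r i) u\<bar> \<le> 1" if "u \<in> {-1..1}" for i u
            using mult_mono[of "\<bar>r\<bar>" 1 "\<bar>poly (P i) u\<bar>" 1] coord[OF that] elim(2) by (simp add: Q_def abs_mult)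
          show "\<bar>iter_partial is f (poly_curve (Q r) x)\<bar> \<le> M'" if "length is \<le> D" "D \<le> s * length is" for "is"
            using elim(1)[rule_format, of "is" x] M[OF x that] x that(1) by (simp add: Q)
        qed (use x that \<open>M' > M\<close> \<open>M \<ge> 0\<close> in auto)
      qed (use A t in auto)
      then show ?case unfolding h0 B_def by (simp add: mult_ac)
    qed
    moreover have lim: "((\<lambda>r. f (r *\<^sub>R poly_curve P u)) \<longlongrightarrow> f (poly_curve P u)) (at_left 1)"
      if u: "u \<in> {-1..1}" for u
    proof (rule continuous_on_tendsto_compose[of "cball 0 1" f "\<lambda>r. r *\<^sub>R poly_curve P u"])
      show "continuous_on (cball 0 1) f" using f by (simp add: smooth_on_ball_def)
      have "((\<lambda>r. r *\<^sub>R poly_curve P u) \<longlongrightarrow> 1 *\<^sub>R poly_curve P u) (at_left 1)"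
        by (intro tendsto_intros)
      then show "((\<lambda>r. r *\<^sub>R poly_curve P u) \<longlongrightarrow> poly_curve P u) (at_left 1)" by simp
      have "\<forall>\<^sub>F r in at_left 1. r \<in> {0<..<1::real}"
        by (intro eventually_at_leftI[of 0]) auto
      then show "\<forall>\<^sub>F r in at_left 1. r *\<^sub>R poly_curve P u \<in> cball 0 1"
      proof eventually_elim
        case (elim r)
        then show ?case using scaleR_in_ball[OF _ _ c[OF u], of r] ball_subset_cball by auto
      qed
    qed (use c[OF u] in auto)
    moreover have "((\<lambda>r. (\<Sum>a\<in>A. \<bar>f (r *\<^sub>R poly_curve P a)\<bar> * \<bar>poly (lagrange_basis A a) t\<bar>) + B * M')
       \<longlongrightarrow> (\<Sum>a\<in>A. \<bar>f (poly_curve P a)\<bar> * \<bar>poly (lagrange_basis A a) t\<bar>) + B * M') (at_left 1)"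
      using A by (intro tendsto_intros lim) auto
    ultimately have "\<bar>f (poly_curve P t)\<bar> \<le> (\<Sum>a\<in>A. \<bar>f (poly_curve P a)\<bar> * \<bar>poly (lagrange_basis A a) t\<bar>) + B * M'"
      by (intro tendsto_le[OF trivial_limit_at_left_real _ tendsto_rabs[OF lim[OF t]]])
    also have "(\<Sum>a\<in>A. \<bar>f (poly_curve P a)\<bar> * \<bar>poly (lagrange_basis A a) t\<bar>) = 0"
      using A by (intro sum.neutral) auto
    finally show ?thesis by simp
  qed
  note bound = this
  have "\<bar>f (poly_curve P t)\<bar> / B \<le> M'" if "M' > M" for M'
    using bound[OF that] B by (simp add: field_simps)
  then have "\<bar>f (poly_curve P t)\<bar> / B \<le> M" by (rule dense_ge)
  then show ?thesis unfolding B_def[symmetric] using B by (simp add: field_simps)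
qed

section \<open>Comparison of constants, growth of the orders, and the norms\<close>

text \<open>With D = d + 1, this combines n + D \<le> (n + 1) D with 2^D (D + 1) \<le> D^(2D) and 2
  \<le> n + 1. The factor D + 1 is the gain that replaces (d + 1)! by (d + 2)!.\<close>

lemma C_const_bound:
  assumes "s \<ge> 1" "n \<ge> 1" "d \<ge> 1"
  shows "real (n + (d + 1)) ^ (d + 1) * (2 * real s ^ 2) ^ (d + 1) * (real (d + 1) + 1) * C_const n d s \<le> 1"
proof -
  define D where "D = d + 1"
  have D: "D \<ge> 2" using assms by (simp add: D_def)
  have "n + D \<le> (n + 1) * D"
    using mult_le_mono2[of 1 D n] D by (simp add: algebra_simps)
  then have "real (n + D) ^ D \<le> (real (n + 1) * real D) ^ D"
    unfolding of_nat_mult[symmetric] by (intro power_mono) (simp_all only: of_nat_le_iff of_nat_0_le_iff)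
  moreover have "2 ^ D * (real D + 1) \<le> real D ^ (D * (n + 1))"
  proof -
    have "real D * 2 \<le> real D * real D" using D by (intro mult_left_mono) auto
    moreover have "real D \<ge> 2" using D by simp
    ultimately have "real D + 1 \<le> real D ^ 2" unfolding power2_eq_square by linarith
    also have "\<dots> \<le> real D ^ D" using D by (intro power_increasing) auto
    finally have "2 ^ D * (real D + 1) \<le> real D ^ D * real D ^ D"
      using D by (intro mult_mono power_mono) auto
    also have "\<dots> = real D ^ (D * 2)" by (simp add: mult_2_right power_add)
    also have "\<dots> \<le> real D ^ (D * (n + 1))" using D assms(2) by (intro power_increasing mult_le_mono2) auto
    finally show ?thesis .
  qed
  ultimately have "real (n + D) ^ D * (2 ^ D * (real D + 1)) * (real s ^ (2 * D))
      \<le> (real (n + 1) * real D) ^ D * real D ^ (D * (n + 1)) * (real s ^ (2 * D))"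
    by (intro mult_mono) auto
  also have "\<dots> = real s ^ (2 * D) * real (n + 1) ^ D * real D ^ (D * (n + 2))"
  proof -
    have "D * (n + 2) = D + D * (n + 1)" by simp
    then show ?thesis by (simp only: power_add power_mult_distrib mult_ac)
  qed
  finally have "real (n + D) ^ D * (2 * real s ^ 2) ^ D * (real D + 1)
      \<le> real s ^ (2 * D) * real (n + 1) ^ D * real D ^ (D * (n + 2))"
    by (simp only: power_mult_distrib power_mult[symmetric] mult_ac)
  moreover have "real s ^ (2 * D) * real (n + 1) ^ D * real D ^ (D * (n + 2)) > 0"
    using assms D by (intro mult_pos_pos zero_less_power) auto
  ultimately show ?thesis unfolding C_const_def D_def[symmetric] by (simp add: pos_divide_le_eq)
qed

lemma eta_le_half: "s \<ge> 1 \<Longrightarrow> eta d s \<le> (d + 1) div 2 + 1"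
  unfolding eta_def using div_le_mono2[of 2 "s + 1" "d + 1"] by simp

text \<open>Places the orders contributing to the chain rule in the interval: d + 1 is strictly
  below l (s + 1), so the quotient is below l and the + 1 in \<open>eta\<close> is absorbed.\<close>

lemma eta_le_length:
  assumes "d + 1 \<le> s * l"
  shows "eta d s \<le> l"
proof -
  have "l > 0" using assms by (cases l) auto
  then have "d + 1 < l * (s + 1)" using assms by (simp add: algebra_simps)
  then show ?thesis unfolding eta_def using less_mult_imp_div_less[of "d + 1" l "s + 1"] by simp
qed

text \<open>The \<open>LEAST\<close> has its defining property because \<open>eta\<close> is
  unbounded; \<open>(s + 1) * x\<close> is a witness exceeding \<open>x\<close>.\<close>

lemma dseq_less_eta: "dseq s (Suc j) < eta (dseq s (Suc (Suc j))) s"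
proof -
  have "\<exists>d. eta d s > x" for x
  proof
    have "x \<le> ((s + 1) * x + 1) div (s + 1)"
      by (subst less_eq_div_iff_mult_less_eq) (simp_all add: algebra_simps)
    then show "eta ((s + 1) * x) s > x" unfolding eta_def by linarith
  qed
  then show ?thesis unfolding dseq.simps by (rule LeastI_ex)
qed

text \<open>Since \<open>eta\<close> is at most about half its argument, the sequence nearly doubles
  at each step. The last claim makes \<open>theta\<close> at least 1.\<close>

lemma dseq_props:
  assumes s: "s \<ge> 1"
  shows "dseq s (Suc j) \<ge> 5" and "dseq s (Suc j) < dseq s (Suc (Suc j))"
    and "eta (dseq s (Suc j)) s \<le> dseq s (Suc j)"
proof -
  have step: "2 * dseq s (Suc j) \<le> dseq s (Suc (Suc j)) + 1" for j
    using dseq_less_eta[of s j] eta_le_half[OF s, of "dseq s (Suc (Suc j))"] by linarith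
  have ge: "dseq s (Suc j) \<ge> 5" for j
  proof (induction j)
    case (Suc j)
    then show ?case using step[of j] by linarith
  qed (use s in simp)
  show "dseq s (Suc j) \<ge> 5" by (rule ge)
  show "dseq s (Suc j) < dseq s (Suc (Suc j))" using step[of j] ge[of j] by linarith
  show "eta (dseq s (Suc j)) s \<le> dseq s (Suc j)"
    using eta_le_half[OF s, of "dseq s (Suc j)"] ge[of j] by linarith
qed

text \<open>A real supremum bounds its members only if the set is bounded above; compactness
  provides this.\<close>

lemma bdd_above_curve_norm:
  fixes \<omega> :: "real \<Rightarrow> real ^ 'n::finite"
  assumes "smooth_on_ball f" and "continuous_on {-1..1} \<omega>" and "\<omega> ` {-1..1} \<subseteq> cball 0 1"
  shows "bdd_above ((\<lambda>t. \<bar>multi_deriv \<alpha> f (\<omega> t)\<bar>) ` {-1..1})"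
proof (intro bounded_imp_bdd_above compact_imp_bounded compact_continuous_image continuous_intros)
  show "continuous_on {-1..1} (\<lambda>t. multi_deriv \<alpha> f (\<omega> t))"
    using continuous_on_compose2[OF continuous_on_multi_deriv[OF assms(1)] assms(2,3)] .
qed auto

lemma curve_norm_le_order_norm:
  fixes f :: "real ^ 'n::finite \<Rightarrow> real" and \<omega> :: "real \<Rightarrow> real ^ 'n"
  assumes f: "smooth_on_ball f" and \<omega>: "\<omega> ` {-1..1} \<subseteq> cball 0 1"
  shows "curve_norm \<omega> \<alpha> f \<le> order_norm (msize \<alpha>) f"
  unfolding curve_norm_def
proof (rule cSUP_least)
  fix t :: real assume t: "t \<in> {-1..1}"
  have fin: "finite {\<beta> :: 'n \<Rightarrow> nat. msize \<beta> = msize \<alpha>}"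
    by (rule finite_subset[OF _ finite_msize[of "msize \<alpha>" "msize \<alpha>"]]) auto
  have "\<bar>multi_deriv \<alpha> f (\<omega> t)\<bar> \<le> (\<Sum>\<beta> | msize \<beta> = msize \<alpha>. \<bar>multi_deriv \<beta> f (\<omega> t)\<bar>)"
    using fin by (intro member_le_sum) auto
  also have "\<dots> \<le> order_norm (msize \<alpha>) f"
    unfolding order_norm_def
  proof (rule cSUP_upper[OF subsetD[OF \<omega> imageI[OF t]]])
    show "bdd_above ((\<lambda>x. \<Sum>\<beta> | msize \<beta> = msize \<alpha>. \<bar>multi_deriv \<beta> f x\<bar>) ` cball 0 1)"
      by (intro bounded_imp_bdd_above compact_imp_bounded compact_continuous_image
           continuous_intros continuous_on_multi_deriv f compact_cball)
  qed
  finally show "\<bar>multi_deriv \<alpha> f (\<omega> t)\<bar> \<le> order_norm (msize \<alpha>) f" .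
qed simp

text \<open>The multi-index maximising the norm along the curve is taken. Its norm \<open>M\<close>
  bounds every derivative entering \<open>curve_value_bound\<close>, and
  \<open>C_const_bound\<close> compares the constants.\<close>

lemma ex_large_curve_norm:
  fixes f :: "real ^ 'n::finite \<Rightarrow> real"
  assumes s: "s \<ge> 1" and f: "smooth_on_ball f"
    and deg: "\<And>i. degree (P i) \<le> s" and \<omega>: "\<And>t. t \<in> {-1..1} \<Longrightarrow> \<omega> t = poly_curve P t"
    and ball: "\<omega> ` {-1..1} \<subseteq> cball 0 1"
    and inf: "infinite {t \<in> {-1..1}. f (\<omega> t) = 0}"
    and m: "m = (SUP t\<in>{-1..1}. \<bar>f (\<omega> t)\<bar>)"
    and d: "d \<ge> 1"
  shows "\<exists>\<alpha>. msize \<alpha> \<in> {eta d s..d + 1} \<and>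
    m * fact (d + 2) * C_const CARD('n) d s / 2 ^ (d + 1) \<le> curve_norm \<omega> \<alpha> f"
proof -
  define S where "S = {\<alpha> :: 'n \<Rightarrow> nat. msize \<alpha> \<in> {eta d s..d + 1}}"
  define M where "M = Max ((\<lambda>\<alpha>. curve_norm \<omega> \<alpha> f) ` S)"
  have cont: "continuous_on {-1..1} \<omega>"
    by (rule continuous_on_eq[OF continuous_on_poly_curve[of _ P]]) (simp add: \<omega>)
  have le_norm: "\<bar>multi_deriv \<alpha> f (\<omega> t)\<bar> \<le> curve_norm \<omega> \<alpha> f" if "t \<in> {-1..1}" for \<alpha> t
    unfolding curve_norm_def by (rule cSUP_upper[OF that bdd_above_curve_norm[OF f cont ball]])
  have finS: "finite S" unfolding S_def by (rule finite_msize)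
  \<comment> \<open>A list repeating one direction shows that the maximum is over a nonempty
    set.\<close>
  have "msize (count_list (replicate (d + 1) (undefined :: 'n))) = d + 1" by (simp only: msize_count_list length_replicate)
  moreover have "eta d s \<le> d + 1" using eta_le_half[OF s, of d] d by linarith
  ultimately have neS: "S \<noteq> {}" unfolding S_def by (auto intro!: exI[of _ "count_list (replicate (d + 1) undefined)"])
  have le_M: "curve_norm \<omega> \<alpha> f \<le> M" if "\<alpha> \<in> S" for \<alpha> unfolding M_def using finS that by auto
  have "M \<in> (\<lambda>\<alpha>. curve_norm \<omega> \<alpha> f) ` S" unfolding M_def using finS neS by (intro Max_in) auto
  then obtain \<alpha> where \<alpha>: "\<alpha> \<in> S" "M = curve_norm \<omega> \<alpha> f" by blast
  have M0: "M \<ge> 0" unfolding \<alpha>(2) by (rule order.trans[OF abs_ge_zero le_norm[of 0]]) simp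
  define B where "B = real (CARD('n) + (d + 1)) ^ (d + 1) * (2 * real s ^ 2) ^ (d + 1)"
  have "m \<le> B * 2 ^ (d + 1) / fact (d + 1) * M"
    unfolding m
  proof (rule cSUP_least)
    fix t :: real assume t: "t \<in> {-1..1}"
    show "\<bar>f (\<omega> t)\<bar> \<le> B * 2 ^ (d + 1) / fact (d + 1) * M"
      unfolding \<omega>[OF t] B_def
    proof (rule curve_value_bound[OF f deg s _ _ _ M0 t])
      have "{t \<in> {-1..1}. f (\<omega> t) = 0} = {t \<in> {-1..1}. f (poly_curve P t) = 0}" by (auto simp: \<omega>)
      then show "infinite {t \<in> {-1..1}. f (poly_curve P t) = 0}" using inf by simp
      fix u :: real assume u: "u \<in> {-1..1}"
      then show c: "poly_curve P u \<in> cball 0 1" using ball \<omega>[OF u] by (metis image_subset_iff)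
      fix "is" :: "'n list" assume l: "length is \<le> d + 1" "d + 1 \<le> s * length is"
      then have "count_list is \<in> S" unfolding S_def using eta_le_length[OF l(2)] by (simp add: msize_count_list)
      then show "\<bar>ext_partial is f (poly_curve P u)\<bar> \<le> M"
        using le_norm[OF u, of "count_list is"] le_M multi_deriv_eq_ext_partial[OF f c, of "is"]
        by (fastforce simp: \<omega>[OF u])
    qed
  qed simp
  then have "m * (fact (d + 2) * C_const CARD('n) d s / 2 ^ (d + 1))
      \<le> B * 2 ^ (d + 1) / fact (d + 1) * M * (fact (d + 2) * C_const CARD('n) d s / 2 ^ (d + 1))"
    by (rule mult_right_mono) (simp add: C_const_def)
  also have "\<dots> = B * (real (d + 1) + 1) * C_const CARD('n) d s * M"
  proof -
    have "fact (d + 2) = (real (d + 1) + 1) * fact (d + 1)" by (simp add: numeral_2_eq_2 algebra_simps)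
    then show ?thesis by (simp add: field_simps del: fact_Suc power_Suc)
  qed
  also have "\<dots> \<le> 1 * M"
    unfolding B_def using C_const_bound[OF s _ d, of "CARD('n)"] M0 by (intro mult_right_mono) (auto simp: Suc_le_eq)
  finally show ?thesis using \<alpha> by (auto simp: S_def mult.assoc)
qed

theorem corollary3p1:
  fixes f :: "real ^ 'n::finite \<Rightarrow> real"
    and \<omega> :: "real \<Rightarrow> real ^ 'n"
    and s :: nat and m :: real and Z :: "(real ^ 'n) set"
  assumes "s \<ge> 1"
    and "smooth_on_ball f"
    and "Z = {x \<in> cball 0 1. f x = 0}"
    and "\<And>i. \<exists>p :: real poly. degree p \<le> s \<and> (\<forall>t\<in>{-1..1}. \<omega> t $ i = poly p t)"
    and "\<omega> ` {-1..1} \<subseteq> cball 0 1"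
    and "\<not> \<omega> ` {-1..1} \<subseteq> Z"
    and "m = (SUP t\<in>{-1..1}. \<bar>f (\<omega> t)\<bar>)"
    and "infinite (Z \<inter> \<omega> ` {-1..1})"
  shows "m > 0 \<and>
    (\<forall>j\<ge>2. (\<Sum>\<alpha> | msize \<alpha> \<in> order_interval s j. curve_norm \<omega> \<alpha> f)
        \<ge> m * fact (dseq s j + 1) * C_const CARD('n) (dseq s j) s / 2 ^ (dseq s j + 1)) \<and>
    (\<exists>(J :: nat set) (k :: nat \<Rightarrow> nat). infinite J \<and> J \<subseteq> {2..} \<and> strict_mono_on J k \<and>
       (\<forall>j\<in>J. k j \<in> order_interval s j \<and>
          order_norm (k j) f
            \<ge> m * fact (k j + 1) * C_const CARD('n) (dseq s j) s
                / (theta s j * 2 ^ (dseq s j + 1))))"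
proof -
  note s = assms(1) and f = assms(2) and ball = assms(5) and m = assms(7)
  obtain P where P: "\<And>i. degree (P i) \<le> s" "\<And>i t. t \<in> {-1..1} \<Longrightarrow> \<omega> t $ i = poly (P i) t"
    using assms(4) by metis
  have \<omega>: "\<omega> t = poly_curve P t" if "t \<in> {-1..1}" for t
    using P(2)[OF that] by (simp add: poly_curve_def vec_eq_iff)
  have cont: "continuous_on {-1..1} \<omega>"
    by (rule continuous_on_eq[OF continuous_on_poly_curve[of _ P]]) (simp add: \<omega>)
  \<comment> \<open>Infinitely many zeros on the image need infinitely many parameters, and
    interpolation takes place in the parameter.\<close>
  have "Z \<inter> \<omega> ` {-1..1} \<subseteq> \<omega> ` {t \<in> {-1..1}. f (\<omega> t) = 0}" by (auto simp: assms(3))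
  then have inf: "infinite {t \<in> {-1..1}. f (\<omega> t) = 0}"
    using assms(8) finite_surj by blast
  obtain t0 where t0: "t0 \<in> {-1..1}" "\<omega> t0 \<notin> Z" using assms(6) by blast
  then have ft0: "f (\<omega> t0) \<noteq> 0" using ball by (auto simp: assms(3) image_subset_iff)
  have "continuous_on {-1..1} (\<lambda>t. \<bar>f (\<omega> t)\<bar>)"
    using f by (intro continuous_intros continuous_on_compose2[OF _ cont ball]) (simp add: smooth_on_ball_def)
  then have "bdd_above ((\<lambda>t. \<bar>f (\<omega> t)\<bar>) ` {-1..1})"
    by (intro bounded_imp_bdd_above compact_imp_bounded compact_continuous_image) auto
  from cSUP_upper[OF t0(1) this] have m0: "m > 0"
    using ft0 unfolding m by linarith
  have ex: "\<exists>\<alpha>. msize \<alpha> \<in> order_interval s j \<and>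
      m * fact (dseq s j + 2) * C_const CARD('n) (dseq s j) s / 2 ^ (dseq s j + 1) \<le> curve_norm \<omega> \<alpha> f"
    if j: "j \<ge> 2" for j
  proof -
    obtain i where "j = Suc i" using j by (cases j) auto
    then have "dseq s j \<ge> 1" using dseq_props(1)[OF s, of i] by simp
    from ex_large_curve_norm[OF s f P(1) \<omega> ball inf m this] show ?thesis
      unfolding order_interval_def by blast
  qed
  have C0: "C_const n d s \<ge> 0" for n d by (simp add: C_const_def)
  \<comment> \<open>Used with k = d + 1 for the sum and with k = k_j + 1 \<le> d + 2 for single
    orders.\<close>
  have fact_mono_bound: "m * fact k * C_const CARD('n) d s / 2 ^ (d + 1)
      \<le> m * fact (d + 2) * C_const CARD('n) d s / 2 ^ (d + 1)" if "k \<le> d + 2" for k d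
    using m0 C0 that by (intro divide_right_mono mult_right_mono mult_left_mono fact_mono) auto
  have "(\<Sum>\<alpha> | msize \<alpha> \<in> order_interval s j. curve_norm \<omega> \<alpha> f)
        \<ge> m * fact (dseq s j + 1) * C_const CARD('n) (dseq s j) s / 2 ^ (dseq s j + 1)" if j: "j \<ge> 2" for j
  proof -
    obtain \<alpha> :: "'n \<Rightarrow> nat" where \<alpha>: "msize \<alpha> \<in> order_interval s j"
      "m * fact (dseq s j + 2) * C_const CARD('n) (dseq s j) s / 2 ^ (dseq s j + 1) \<le> curve_norm \<omega> \<alpha> f"
      using ex[OF j] by blast
    have nonneg: "curve_norm \<omega> \<beta> f \<ge> 0" for \<beta>
      unfolding curve_norm_def
      by (rule order.trans[OF abs_ge_zero cSUP_upper[OF t0(1) bdd_above_curve_norm[OF f cont ball]]])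
    have "finite {\<alpha> :: 'n \<Rightarrow> nat. msize \<alpha> \<in> order_interval s j}"
      unfolding order_interval_def by (rule finite_msize)
    then have "curve_norm \<omega> \<alpha> f \<le> (\<Sum>\<alpha> | msize \<alpha> \<in> order_interval s j. curve_norm \<omega> \<alpha> f)"
      using \<alpha>(1) nonneg by (intro member_le_sum) auto
    then show ?thesis using \<alpha>(2) fact_mono_bound[of "dseq s j + 1" "dseq s j"] by linarith
  qed
  moreover have "\<exists>(J :: nat set) k. infinite J \<and> J \<subseteq> {2..} \<and> strict_mono_on J k \<and>
       (\<forall>j\<in>J. k j \<in> order_interval s j \<and>
          order_norm (k j) f
            \<ge> m * fact (k j + 1) * C_const CARD('n) (dseq s j) s
                / (theta s j * 2 ^ (dseq s j + 1)))"
  proof -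
    obtain \<alpha> :: "nat \<Rightarrow> 'n \<Rightarrow> nat" where \<alpha>: "\<And>j. j \<ge> 2 \<Longrightarrow> msize (\<alpha> j) \<in> order_interval s j"
      "\<And>j. j \<ge> 2 \<Longrightarrow> m * fact (dseq s j + 2) * C_const CARD('n) (dseq s j) s / 2 ^ (dseq s j + 1)
            \<le> curve_norm \<omega> (\<alpha> j) f"
      using ex by metis
    \<comment> \<open>Consecutive intervals may share an endpoint, so only every second one is used.\<close>
    define J where "J = range (\<lambda>i::nat. 2 * i + 2)"
    define k where "k j = msize (\<alpha> j)" for j
    have "infinite J" unfolding J_def by (intro range_inj_infinite) (auto simp: inj_on_def)
    moreover have "J \<subseteq> {2..}" by (auto simp: J_def)
    moreover have "strict_mono_on J k"
    proof (rule strict_mono_onI)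
      fix a b assume "a \<in> J" "b \<in> J" "a < b"
      then obtain i l where il: "a = 2 * i + 2" "b = 2 * l + 2" "i < l" by (auto simp: J_def)
      have mono: "dseq s (Suc x) \<le> dseq s (Suc y)" if "x \<le> y" for x y
        using lift_Suc_mono_le[of "\<lambda>x. dseq s (Suc x)" x y] dseq_props(2)[OF s] that by (simp add: less_imp_le)
      \<comment> \<open>The skipped index absorbs the + 1 at the right end of the interval of
        \<open>a\<close>, as a + 1 is at most b - 1.\<close>
      have "k a \<le> dseq s a + 1" using \<alpha>(1)[of a] il by (simp add: k_def order_interval_def)
      also have "\<dots> \<le> dseq s (Suc a)" using dseq_props(2)[OF s, of "2 * i + 1"] il by simp
      also have "\<dots> \<le> dseq s (Suc (2 * l))" using il by (intro mono) auto
      also have "\<dots> < eta (dseq s b) s" using dseq_less_eta[of s "2 * l"] il by simp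
      also have "\<dots> \<le> k b" using \<alpha>(1)[of b] il by (simp add: k_def order_interval_def)
      finally show "k a < k b" .
    qed
    moreover have "k j \<in> order_interval s j \<and> order_norm (k j) f
            \<ge> m * fact (k j + 1) * C_const CARD('n) (dseq s j) s / (theta s j * 2 ^ (dseq s j + 1))"
      if "j \<in> J" for j
    proof
      have j: "j \<ge> 2" using that by (auto simp: J_def)
      then obtain i where i: "j = Suc i" by (cases j) auto
      show kj: "k j \<in> order_interval s j" using \<alpha>(1)[OF j] by (simp add: k_def)
      \<comment> \<open>Division by a number at least 1 only weakens the lower bound.\<close>
      have \<theta>: "theta s j \<ge> 1" using dseq_props(3)[OF s, of i] i by (simp add: theta_def)
      have "m * fact (k j + 1) * C_const CARD('n) (dseq s j) s / (theta s j * 2 ^ (dseq s j + 1))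
          \<le> m * fact (k j + 1) * C_const CARD('n) (dseq s j) s / 2 ^ (dseq s j + 1)"
        using \<theta> m0 C0 by (intro divide_left_mono mult_nonneg_nonneg) auto
      also have "\<dots> \<le> m * fact (dseq s j + 2) * C_const CARD('n) (dseq s j) s / 2 ^ (dseq s j + 1)"
        using kj by (intro fact_mono_bound) (simp add: order_interval_def)
      also have "\<dots> \<le> curve_norm \<omega> (\<alpha> j) f" by (rule \<alpha>(2)[OF j])
      also have "\<dots> \<le> order_norm (k j) f" unfolding k_def by (rule curve_norm_le_order_norm[OF f ball])
      finally show "order_norm (k j) f
          \<ge> m * fact (k j + 1) * C_const CARD('n) (dseq s j) s / (theta s j * 2 ^ (dseq s j + 1))" .
    qed
    ultimately show ?thesis by blast
  qed
  ultimately show ?thesis using m0 by blast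
qed

end
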